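(* Let $(\mathbb{R}^d,\cdot,X,K)$ be a sub-Finsler nilpotent group. The isoperimetric profile $I_K$ is sub-additive, i.e. $I_K(v+w)\le I_K(v)+I_K(w)$ for all $v,w>0$.
   Context: Setting. A nilpotent group is a connected, simply connected Lie group $G$ whose Lie algebra $\mathfrak{g}$ is nilpotent. With $\mathfrak{g}_0=\mathfrak{g}$, $\mathfrak{g}_{i+1}=[\mathfrak{g},\mathfrak{g}_i]$ and $r$ the step ($\mathfrak{g}_r=0\ne\mathfrak{g}_{r-1}$), fix a Malcev basis $\{Y_1,\dots,Y_d\}$ of $\mathfrak{g}$, i.e. a basis such that each $\mathrm{span}\{Y_{d-n+1},\dots,Y_d\}$, $1\le n\le d$, is an ideal and each $\mathfrak{g}_i$, $0\le i\le r-1$, is one of these ideals. Identify $G$ with $(\mathbb{R}^d,\cdot)$ via $(x_1,\dots,x_d)\mapsto\exp(x_1Y_1+\dots+x_dY_d)$; the identity is $0$. The Lebesgue measure $|\cdot|$ of $\mathbb{R}^d$ is then a Haar measure of the group. $X=\{X_1,\dots,X_k\}$ is a system of linearly independent left-invariant vector fields. Put $\mathcal{H}^0=\mathrm{span}(X)$ and $\mathcal{H}^n=\mathcal{H}^{n-1}+[\mathcal{H}^{n-1},\mathcal{H}^0]$; $X$ is assumed to be Lie bracket generating, i.e. $\mathcal{H}^s(0)=\mathfrak{g}$ for some $s$. Vector fields tangent to $\mathcal{H}^0$ at every point are called horizontal. Fix a left-invariant Riemannian metric $g=\langle\cdot,\cdot\rangle$ for which $X$ is an orthonormal basis of $\mathcal{H}^0$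 and $\mathcal{H}^0$ is orthogonal to a chosen complementary subbundle $V$; $\operatorname{div}$ is the divergence with respect to $g$. $K\subset\mathcal{H}^0_0$ is a convex body (compact convex set) with $0$ in its interior (relative to $\mathcal{H}^0_0$), not necessarily symmetric. It defines the asymmetric norm $\|u\|_K=\inf\{\lambda\ge0:u\in\lambda K\}$ on $\mathcal{H}^0_0$, extended to $\mathcal{H}^0$ by left-invariance: $\|\sum_i a_iX_i(p)\|_K=\|\sum_i a_iX_i(0)\|_K$. The data $(\mathbb{R}^d,\cdot,X,K)$ is called a sub-Finsler nilpotent group. Perimeter. For a measurable set $E\subseteq\mathbb{R}^d$, $P_K(E)=\sup\{\int_E\operatorname{div}(U)\,dx\}$, the supremum being over compactly supported $C^1$ horizontal vector fields $U$ on $\mathbb{R}^d$ with $\sup_p\|U_p\|_K\le1$. $E$ is a finite perimeter set if $P_K(E)<+\infty$. Isoperimetric profile. For $v>0$, $I_K(v)=\inf\{P_K(E): E\subseteq\mathbb{R}^d \text{ is a finite perimeter set and } |E|=v\}$. *)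

theory Defs
  imports "HOL-Analysis.Analysis"
begin

section \<open>Differentiability classes\<close>

text \<open>\<open>C_diff k f\<close>: \<open>f\<close> is of class $C^k$ on the whole (finite-dimensional) space.\<close>

fun C_diff :: "nat \<Rightarrow> ('a::real_normed_vector \<Rightarrow> 'b::real_normed_vector) \<Rightarrow> bool" where
  "C_diff 0 f \<longleftrightarrow> continuous_on UNIV f"
| "C_diff (Suc k) f \<longleftrightarrow> (\<forall>x. f differentiable (at x)) \<and>
     (\<forall>v. C_diff k (\<lambda>x. frechet_derivative f (at x) v))"

definition smooth :: "('a::real_normed_vector \<Rightarrow> 'b::real_normed_vector) \<Rightarrow> bool" where
  "smooth f \<longleftrightarrow> (\<forall>k. C_diff k f)"

section \<open>The Lie algebra of a group structure on \<open>\<real>\<^sup>d\<close>\<close>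

type_synonym 'd point = "real ^ 'd"
type_synonym 'd group_op = "'d point \<Rightarrow> 'd point \<Rightarrow> 'd point"
type_synonym 'd vfield = "'d point \<Rightarrow> 'd point"
type_synonym 'd subbundle = "'d point \<Rightarrow> 'd point set"
type_synonym 'd metric_tensor = "'d point \<Rightarrow> 'd point \<Rightarrow> 'd point \<Rightarrow> real"

definition left_invariant :: "('d::finite) group_op \<Rightarrow> 'd vfield \<Rightarrow> bool" where
  "left_invariant gmult V \<longleftrightarrow>
     (\<forall>x y. V (gmult x y) = frechet_derivative (gmult x) (at y) (V y))"

text \<open>The left-invariant field with value \<open>u\<close> at the neutral element.\<close>

definition left_field :: "('d::finite) group_op \<Rightarrow> 'd point \<Rightarrow> 'd vfield" where
  "left_field gmult u x = frechet_derivative (gmult x) (at 0) u"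

text \<open>The commutator \<open>[V, W] = V W - W V\<close> of vector fields regarded as derivations.\<close>

definition vfield_bracket :: "('d::finite) vfield \<Rightarrow> 'd vfield \<Rightarrow> 'd vfield" where
  "vfield_bracket V W x =
     frechet_derivative W (at x) (V x) - frechet_derivative V (at x) (W x)"

text \<open>The Lie algebra is the tangent space \<open>\<real>\<^sup>d\<close> at the neutral element, a vector \<open>u\<close> standing
  for the left-invariant field \<open>left_field gmult u\<close>.\<close>

definition lie_bracket :: "('d::finite) group_op \<Rightarrow> 'd point \<Rightarrow> 'd point \<Rightarrow> 'd point" where
  "lie_bracket gmult u v = vfield_bracket (left_field gmult u) (left_field gmult v) 0"

definition bracket_span ::
  "('d::finite) group_op \<Rightarrow> 'd point set \<Rightarrow> 'd point set \<Rightarrow> 'd point set" where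
  "bracket_span gmult A B = span {lie_bracket gmult u v | u v. u \<in> A \<and> v \<in> B}"

primrec lower_central :: "('d::finite) group_op \<Rightarrow> nat \<Rightarrow> 'd point set" where
  "lower_central gmult 0 = UNIV"
| "lower_central gmult (Suc i) = bracket_span gmult UNIV (lower_central gmult i)"

definition lie_nilpotent :: "('d::finite) group_op \<Rightarrow> bool" where
  "lie_nilpotent gmult \<longleftrightarrow> (\<exists>r. lower_central gmult r = {0})"

definition nilpotency_step :: "('d::finite) group_op \<Rightarrow> nat" where
  "nilpotency_step gmult = (LEAST r. lower_central gmult r = {0})"

definition lie_ideal :: "('d::finite) group_op \<Rightarrow> 'd point set \<Rightarrow> bool" where
  "lie_ideal gmult I \<longleftrightarrow> subspace I \<and> (\<forall>u. \<forall>v\<in>I. lie_bracket gmult u v \<in> I)"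

section \<open>Nilpotent groups in exponential Malcev coordinates\<close>

text \<open>The index type \<open>'d\<close> is linearly ordered, so the standard basis is ordered; for
  the \<open>n\<close>-th largest index \<open>j\<close> this is the span of the last \<open>n\<close> basis vectors.\<close>

definition tail_span :: "'d::{finite,linorder} \<Rightarrow> 'd point set" where
  "tail_span j = span {axis i 1 | i. j \<le> i}"

text \<open>Identifying the group with \<open>\<real>\<^sup>d\<close> by \<open>x \<mapsto> exp (\<Sum>i. x\<^sub>i Y\<^sub>i)\<close> makes \<open>Y\<^sub>i\<close> the left-invariant
  field whose value at \<open>0\<close> is the \<open>i\<close>-th standard basis vector, and makes \<open>exp\<close> the identity of
  \<open>\<real>\<^sup>d\<close>. The latter says that \<open>t \<mapsto> t u\<close> is the one-parameter subgroup with velocity \<open>u\<close>, for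
  every \<open>u\<close>; this is \<open>exponential\<close>, and it forces the inverse of \<open>x\<close> to be \<open>- x\<close>.\<close>

locale nilpotent_group =
  fixes gmult :: "('d::{finite,linorder}) group_op"
  assumes group: "Groups.group gmult 0 uminus"
    and smooth_mult: "smooth (\<lambda>(x, y). gmult x y)"
    and exponential: "gmult (s *\<^sub>R u) (t *\<^sub>R u) = (s + t) *\<^sub>R u"
    and nilpotent: "lie_nilpotent gmult"
    and malcev_ideal: "lie_ideal gmult (tail_span j)"
    and malcev_central: "i < nilpotency_step gmult \<Longrightarrow> \<exists>j. lower_central gmult i = tail_span j"

section \<open>Sub-Finsler structures\<close>

text \<open>The horizontal bundle \<open>\<H>\<^sup>0\<close>, spanned by the frame \<open>X\<close>.\<close>

definition horizontal :: "('k::finite \<Rightarrow> ('d::finite) vfield) \<Rightarrow> 'd subbundle" where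
  "horizontal X p = span (range (\<lambda>i. X i p))"

text \<open>The filtration \<open>\<H>\<^sup>n\<close>, as subspaces of the Lie algebra.\<close>

primrec hor_filtration ::
  "('d::finite) group_op \<Rightarrow> ('k::finite \<Rightarrow> 'd vfield) \<Rightarrow> nat \<Rightarrow> 'd point set" where
  "hor_filtration gmult X 0 = horizontal X 0"
| "hor_filtration gmult X (Suc n) =
     {u + v | u v. u \<in> hor_filtration gmult X n \<and>
        v \<in> bracket_span gmult (hor_filtration gmult X n) (horizontal X 0)}"

definition riemannian_metric :: "('d::finite) metric_tensor \<Rightarrow> bool" where
  "riemannian_metric g \<longleftrightarrow>
     (\<forall>p. bilinear (g p) \<and> (\<forall>u v. g p u v = g p v u) \<and> (\<forall>u. u \<noteq> 0 \<longrightarrow> g p u u > 0)) \<and>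
     (\<forall>u v. smooth (\<lambda>p. g p u v))"

definition left_invariant_metric ::
  "('d::finite) group_op \<Rightarrow> 'd metric_tensor \<Rightarrow> bool" where
  "left_invariant_metric gmult g \<longleftrightarrow>
     (\<forall>x y u v. g (gmult x y) (frechet_derivative (gmult x) (at y) u)
        (frechet_derivative (gmult x) (at y) v) = g y u v)"

text \<open>\<open>K\<close> is the convex body, \<open>g\<close> the metric and \<open>V\<close> the chosen complement of the horizontal
  bundle. Left invariance and smoothness of \<open>V\<close> follow from \<open>V_orthogonal\<close>.\<close>

locale sub_finsler_nilpotent_group = nilpotent_group gmult
  for gmult :: "('d::{finite,linorder}) group_op" +
  fixes X :: "'k::finite \<Rightarrow> 'd vfield"
    and K :: "'d point set"
    and g :: "'d metric_tensor"
    and V :: "'d subbundle"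
  assumes X_left_invariant: "left_invariant gmult (X i)"
    and X_independent: "(\<And>p. (\<Sum>i\<in>UNIV. c i *\<^sub>R X i p) = 0) \<Longrightarrow> c i = 0"
    and bracket_generating: "\<exists>s. hor_filtration gmult X s = UNIV"
    and metric: "riemannian_metric g" "left_invariant_metric gmult g"
    and X_orthonormal: "g p (X i p) (X j p) = (if i = j then 1 else 0)"
    and V_complement: "subspace (V p)" "horizontal X p \<inter> V p = {0}"
      "{h + v | h v. h \<in> horizontal X p \<and> v \<in> V p} = UNIV"
    and V_orthogonal: "h \<in> horizontal X p \<Longrightarrow> v \<in> V p \<Longrightarrow> g p h v = 0"
    and K_subset: "K \<subseteq> horizontal X 0"
    and K_convex: "convex K"
    and K_compact: "compact K"
    and K_interior: "0 \<in> (top_of_set (horizontal X 0)) interior_of K"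

definition gauge :: "('d::finite) point set \<Rightarrow> 'd point \<Rightarrow> real" where
  "gauge K u = Inf {l::real. 0 \<le> l \<and> u \<in> (\<lambda>x. l *\<^sub>R x) ` K}"

definition frame_coeffs ::
  "('k::finite \<Rightarrow> ('d::finite) vfield) \<Rightarrow> 'd point \<Rightarrow> 'd point \<Rightarrow> 'k \<Rightarrow> real" where
  "frame_coeffs X p u = (THE a. u = (\<Sum>i\<in>UNIV. a i *\<^sub>R X i p))"

text \<open>The left-invariant extension of \<open>gauge K\<close> to a horizontal vector \<open>u\<close> at \<open>p\<close>.\<close>

definition hor_norm ::
  "('k::finite \<Rightarrow> ('d::finite) vfield) \<Rightarrow> 'd point set \<Rightarrow> 'd point \<Rightarrow> 'd point \<Rightarrow> real" where
  "hor_norm X K p u = gauge K (\<Sum>i\<in>UNIV. frame_coeffs X p u i *\<^sub>R X i 0)"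

section \<open>Perimeter and isoperimetric profile\<close>

text \<open>The density \<open>\<surd>(det (g\<^sub>i\<^sub>j))\<close> of the Riemannian volume, and the coordinate formula
  \<open>div U = (1/\<rho>) \<Sum>i. \<partial>\<^sub>i (\<rho> U\<^sup>i)\<close> for the Riemannian divergence.\<close>

definition volume_density :: "('d::finite) metric_tensor \<Rightarrow> 'd point \<Rightarrow> real" where
  "volume_density g p = sqrt (det (\<chi> i j. g p (axis i 1) (axis j 1)))"

definition divergence ::
  "('d::finite) metric_tensor \<Rightarrow> 'd vfield \<Rightarrow> 'd point \<Rightarrow> real" where
  "divergence g U p =
     (\<Sum>i\<in>UNIV. frechet_derivative (\<lambda>q. volume_density g q * U q $ i) (at p) (axis i 1))
       / volume_density g p"

definition admissible_fields ::
  "('k::finite \<Rightarrow> ('d::finite) vfield) \<Rightarrow> 'd point set \<Rightarrow> 'd vfield set" where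
  "admissible_fields X K =
     {U. C_diff 1 U \<and> compact (closure {p. U p \<noteq> 0}) \<and> (\<forall>p. U p \<in> horizontal X p) \<and>
         (\<forall>p. hor_norm X K p (U p) \<le> 1)}"

text \<open>Meant for Lebesgue measurable \<open>E\<close>.\<close>

definition perimeter ::
  "('k::finite \<Rightarrow> ('d::finite) vfield) \<Rightarrow> 'd point set \<Rightarrow> 'd metric_tensor
     \<Rightarrow> 'd point set \<Rightarrow> ereal" where
  "perimeter X K g E = (SUP U\<in>admissible_fields X K. ereal (LINT p:E|lebesgue. divergence g U p))"

definition finite_perimeter ::
  "('k::finite \<Rightarrow> ('d::finite) vfield) \<Rightarrow> 'd point set \<Rightarrow> 'd metric_tensor
     \<Rightarrow> 'd point set \<Rightarrow> bool" where
  "finite_perimeter X K g E \<longleftrightarrow> E \<in> sets lebesgue \<and> perimeter X K g E < \<infinity>"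

definition isoperimetric_profile ::
  "('k::finite \<Rightarrow> ('d::finite) vfield) \<Rightarrow> 'd point set \<Rightarrow> 'd metric_tensor
     \<Rightarrow> real \<Rightarrow> ereal" where
  "isoperimetric_profile X K g v =
     (INF E\<in>{E. finite_perimeter X K g E \<and> emeasure lebesgue E = ennreal v}. perimeter X K g E)"

end

theory Submission
  imports Defs
begin

text \<open>
  Let \<open>P\<close> be the perimeter. If a set \<open>F\<close> of volume \<open>w\<close> can be moved away from a set \<open>E\<close> of volume
  \<open>v\<close>, the union does it: the perimeter of a disjoint union is at most the sum of the perimeters. If \<open>E\<close> and
  \<open>F\<close> are unbounded, no translation need make them disjoint, and truncating them loses volume. The
  remedy is to cut both sets completely: up to an arbitrarily small \<open>\<epsilon>\<close>, a set of finite measure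
  splits into countably many bounded pieces whose perimeters add up to at most \<open>P E + \<epsilon>\<close>
  (\<open>decomposable_finite_measure\<close>). Bounded pieces can be translated apart one by one, and the union
  of all translated pieces of \<open>E\<close> and \<open>F\<close> has volume exactly \<open>v + w\<close> and perimeter at most
  \<open>P E + P F + \<epsilon>\<close> (\<open>disjoint_rearrangement\<close>).

  Translations. The last nontrivial term of the lower central series contains a direction \<open>z\<close> in
  which group translation is Euclidean translation, \<open>gmult (t *\<^sub>R z) y = t *\<^sub>R z + y\<close>
  (\<open>central_direction\<close>). The derivative of such a translation is the identity, so the frame and the
  metric are constant along \<open>z\<close> and both volume and perimeter are preserved. That a central direction
  of the Lie algebra is central in the group uses the exponential coordinates: there squaring is
  doubling, every conjugation commutes with doubling and is therefore linear, and its dependence on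
  the conjugating element is governed by the Lie bracket.

  Cutting. Let \<open>\<phi>\<close> have derivative bounded by \<open>C\<close> along admissible fields at the points of \<open>E\<close>.
  If \<open>U1\<close> and \<open>U2\<close> are admissible, so is their blend by a step function of \<open>\<phi>\<close> that
  rises from 0 to 1 between the levels \<open>r\<close> and \<open>R\<close>, because \<open>K\<close> is convex. In the limit \<open>r \<longlonglongrightarrow> R\<close>,
  testing the perimeter of \<open>E\<close> with this blend bounds the sum of the integrals of the divergence of
  \<open>U1\<close> over \<open>\<phi> < R\<close> and of that of \<open>U2\<close> over \<open>\<phi> \<ge> R\<close> by \<open>P E\<close> plus a multiple of \<open>C / (R - r)\<close>
  times the measure of the part of \<open>E\<close> between the two levels. The function
  \<open>r \<mapsto> |E \<inter> {\<phi> < r}|\<close> is bounded and monotone, so beyond every level there is one at which its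
  growth to the left is as slow as desired (\<open>mono_slow_growth_point\<close>), and there the cut costs at
  most \<open>\<epsilon>\<close> (\<open>perimeter_cut\<close>). Infinitely many cuts with summable costs give shells (\<open>perimeter_shells\<close>).

  The remaining difficulty is to find \<open>\<phi>\<close>, since horizontal fields may grow polynomially and no Euclidean
  norm works at once. But modulo the \<open>(i+1)\<close>-st term of the lower central series a left-invariant
  field depends only on the point modulo the \<open>i\<close>-th term (\<open>left_field_modulo_lower_central\<close>). Hence
  on a set that is bounded modulo the \<open>i\<close>-th term a smoothed norm modulo the \<open>(i+1)\<close>-st term has bounded
  derivative along admissible fields, and cutting by it makes the pieces bounded modulo the
  \<open>(i+1)\<close>-st term. After as many rounds as the nilpotency step, the pieces are bounded.
\<close>

section \<open>Calculus of continuously differentiable maps\<close>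

definition C1 :: "('a::real_normed_vector \<Rightarrow> 'b::real_normed_vector) \<Rightarrow> bool" where
  "C1 = C_diff 1"

lemma C1_iff:
  "C1 f \<longleftrightarrow> (\<forall>x. f differentiable (at x)) \<and>
     (\<forall>v. continuous_on UNIV (\<lambda>x. frechet_derivative f (at x) v))"
  by (simp add: C1_def)

lemma C1I:
  assumes "\<And>x. (f has_derivative f' x) (at x)"
    and "\<And>v. continuous_on UNIV (\<lambda>x. f' x v)"
  shows "C1 f"
proof -
  have "frechet_derivative f (at x) = f' x" for x
    using frechet_derivative_at[OF assms(1)] by simp
  then show ?thesis
    using assms unfolding C1_iff differentiable_def by auto
qed

lemma C1_has_derivative:
  "C1 f \<Longrightarrow> (f has_derivative frechet_derivative f (at x)) (at x)"
  by (simp add: C1_iff frechet_derivative_works)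

lemma C1_continuous_derivative:
  "C1 f \<Longrightarrow> continuous_on UNIV (\<lambda>x. frechet_derivative f (at x) v)"
  by (simp add: C1_iff)

lemma C1_continuous: "C1 f \<Longrightarrow> continuous_on UNIV f"
  by (meson C1_has_derivative continuous_at_imp_continuous_on has_derivative_continuous)

lemma C1_const: "C1 (\<lambda>x. c)"
  by (rule C1I[where f' = "\<lambda>_ _. 0"]) auto

lemma C1_add:
  assumes "C1 f" "C1 h" shows "C1 (\<lambda>x. f x + h x)"
  by (rule C1I[OF has_derivative_add[OF assms[THEN C1_has_derivative]]])
    (intro continuous_intros assms[THEN C1_continuous_derivative])

lemma C1_diff:
  assumes "C1 f" "C1 h" shows "C1 (\<lambda>x. f x - h x)"
  by (rule C1I[OF has_derivative_diff[OF assms[THEN C1_has_derivative]]])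
    (intro continuous_intros assms[THEN C1_continuous_derivative])

lemma C1_scaleR:
  fixes r :: "'a::real_normed_vector \<Rightarrow> real"
  assumes "C1 r" "C1 f" shows "C1 (\<lambda>x. r x *\<^sub>R f x)"
  by (rule C1I[OF has_derivative_scaleR[OF C1_has_derivative[OF assms(1)] C1_has_derivative[OF assms(2)]]])
    (intro continuous_intros C1_continuous_derivative C1_continuous assms)

lemma C1_mult:
  fixes r :: "'a::real_normed_vector \<Rightarrow> real"
  shows "C1 r \<Longrightarrow> C1 f \<Longrightarrow> C1 (\<lambda>x. r x * f x)"
  using C1_scaleR[of r f] by simp

lemma C1_sum:
  assumes "finite I" "\<And>i. i \<in> I \<Longrightarrow> C1 (f i)"
  shows "C1 (\<lambda>x. \<Sum>i\<in>I. f i x)"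
  using assms by (induction I rule: finite_induct) (auto intro: C1_add C1_const)

lemma C1_prod:
  fixes f :: "'i \<Rightarrow> 'a::real_normed_vector \<Rightarrow> real"
  assumes "finite I" "\<And>i. i \<in> I \<Longrightarrow> C1 (f i)"
  shows "C1 (\<lambda>x. \<Prod>i\<in>I. f i x)"
  using assms by (induction I rule: finite_induct) (auto intro: C1_mult C1_const)

lemma C1_bounded_linear:
  assumes "bounded_linear L" "C1 f"
  shows "C1 (\<lambda>x. L (f x))"
  by (rule C1I[OF bounded_linear.has_derivative[OF assms(1) C1_has_derivative[OF assms(2)]]])
    (intro bounded_linear.continuous_on[OF assms(1)] C1_continuous_derivative assms(2))

lemma has_derivative_real_compose:
  fixes f :: "'a::real_normed_vector \<Rightarrow> real"
  assumes "(\<eta> has_real_derivative \<eta>') (at (f x))" "(f has_derivative f') (at x)"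
  shows "((\<lambda>x. \<eta> (f x)) has_derivative (\<lambda>v. \<eta>' * f' v)) (at x)"
  using has_derivative_compose[OF assms(2) assms(1)[unfolded has_field_derivative_def]] by simp

lemma C1_real_compose:
  fixes f :: "'a::real_normed_vector \<Rightarrow> real"
  assumes "\<And>x. (\<eta> has_real_derivative \<eta>' (f x)) (at (f x))"
    and "continuous_on (range f) \<eta>'" and "C1 f"
  shows "C1 (\<lambda>x. \<eta> (f x))"
proof (rule C1I[OF has_derivative_real_compose[OF assms(1) C1_has_derivative[OF assms(3)]]])
  have "continuous_on UNIV (\<lambda>x. \<eta>' (f x))"
    by (rule continuous_on_compose2[OF assms(2) C1_continuous[OF assms(3)]]) auto
  then show "continuous_on UNIV (\<lambda>x. \<eta>' (f x) * frechet_derivative f (at x) v)" for v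
    by (intro continuous_intros C1_continuous_derivative assms(3))
qed

lemma frechet_derivative_translate:
  assumes "\<And>x. f differentiable (at x)"
  shows "frechet_derivative (\<lambda>x. f (z + x)) (at x) = frechet_derivative f (at (z + x))"
proof -
  have "((\<lambda>x. f (z + x)) has_derivative (\<lambda>v. frechet_derivative f (at (z + x)) v)) (at x)"
    by (rule has_derivative_compose[where f = "\<lambda>x. z + x"])
      (use assms in \<open>auto intro!: derivative_eq_intros simp: frechet_derivative_works\<close>)
  from frechet_derivative_at[OF this] show ?thesis by auto
qed

lemma C1_translate:
  assumes "C1 f"
  shows "C1 (\<lambda>x. f (z + x))"
proof (rule C1I[where f' = "\<lambda>x. frechet_derivative f (at (z + x))"])
  show "((\<lambda>x. f (z + x)) has_derivative frechet_derivative f (at (z + x))) (at x)" for x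
    by (rule has_derivative_compose[where f = "\<lambda>x. z + x"])
      (use C1_has_derivative[OF assms] in \<open>auto intro!: derivative_eq_intros\<close>)
  show "continuous_on UNIV (\<lambda>x. frechet_derivative f (at (z + x)) v)" for v
    by (rule continuous_on_compose2[OF C1_continuous_derivative[OF assms]])
      (auto intro!: continuous_intros)
qed

lemma second_difference_mean_value:
  fixes f :: "'a::real_normed_vector \<Rightarrow> real"
  assumes D: "\<And>x. (f has_derivative D x) (at x)"
    and D2: "\<And>x. ((\<lambda>x. D x a) has_derivative D2 x) (at x)"
    and "h > 0"
  shows "\<exists>s t. 0 < s \<and> s < h \<and> 0 < t \<and> t < h \<and>
    f (p + h *\<^sub>R a + h *\<^sub>R b) - f (p + h *\<^sub>R a) - f (p + h *\<^sub>R b) + f p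
      = h\<^sup>2 * D2 (p + s *\<^sub>R a + t *\<^sub>R b) b"
proof -
  have lin: "linear (D x)" "linear (D2 x)" for x
    using D D2 has_derivative_linear by blast+
  have line: "((\<lambda>s. q + s *\<^sub>R c) has_derivative (\<lambda>s. s *\<^sub>R c)) (at s)" for q c :: 'a and s
    by (auto intro!: derivative_eq_intros)
  have 1: "((\<lambda>s. f (q + s *\<^sub>R a)) has_real_derivative D (q + s *\<^sub>R a) a) (at s)" for q s
    unfolding has_field_derivative_def
    using has_derivative_compose[OF line D, of q a s]
    by (simp add: linear_scale[OF lin(1)] mult_commute_abs)
  have 2: "((\<lambda>t. D (q + t *\<^sub>R b) a) has_real_derivative D2 (q + t *\<^sub>R b) b) (at t)" for q t
    unfolding has_field_derivative_def
    using has_derivative_compose[OF line D2, of q b t]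
    by (simp add: linear_scale[OF lin(2)] mult_commute_abs)
  have "\<exists>s. 0 < s \<and> s < h \<and>
     (f ((p + h *\<^sub>R b) + h *\<^sub>R a) - f (p + h *\<^sub>R a)) -
     (f ((p + h *\<^sub>R b) + 0 *\<^sub>R a) - f (p + 0 *\<^sub>R a))
      = (h - 0) * (D ((p + h *\<^sub>R b) + s *\<^sub>R a) a - D (p + s *\<^sub>R a) a)"
    by (rule MVT2[OF \<open>h > 0\<close>]) (intro DERIV_diff 1)
  then obtain s where s: "0 < s" "s < h"
    and eq: "f (p + h *\<^sub>R a + h *\<^sub>R b) - f (p + h *\<^sub>R a) - f (p + h *\<^sub>R b) + f p
      = h * (D ((p + s *\<^sub>R a) + h *\<^sub>R b) a - D ((p + s *\<^sub>R a) + 0 *\<^sub>R b) a)"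
    by (auto simp: algebra_simps)
  obtain t where "0 < t" "t < h"
    "D ((p + s *\<^sub>R a) + h *\<^sub>R b) a - D ((p + s *\<^sub>R a) + 0 *\<^sub>R b) a
      = (h - 0) * D2 ((p + s *\<^sub>R a) + t *\<^sub>R b) b"
    using MVT2[OF \<open>h > 0\<close>, of "\<lambda>t. D ((p + s *\<^sub>R a) + t *\<^sub>R b) a"
        "\<lambda>t. D2 ((p + s *\<^sub>R a) + t *\<^sub>R b) b"] 2 by blast
  with s eq show ?thesis
    by (intro exI[of _ s] exI[of _ t]) (auto simp: power2_eq_square)
qed

text \<open>Applied in both orders, the preceding lemma evaluates the same second difference as either of
  the two mixed derivatives at nearby points; both evaluation points tend to \<open>p\<close> with \<open>h\<close>.\<close>

lemma mixed_second_derivatives_commute_real: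
  fixes f :: "'a::real_normed_vector \<Rightarrow> real"
  assumes D: "\<And>x. (f has_derivative D x) (at x)"
    and A: "\<And>x. ((\<lambda>x. D x a) has_derivative DA x) (at x)" "continuous_on UNIV (\<lambda>x. DA x b)"
    and B: "\<And>x. ((\<lambda>x. D x b) has_derivative DB x) (at x)" "continuous_on UNIV (\<lambda>x. DB x a)"
  shows "DA p b = DB p a"
proof -
  define h where "h n = inverse (real (Suc n))" for n
  have h: "h n > 0" for n by (simp add: h_def)
  have h0: "h \<longlonglongrightarrow> 0" unfolding h_def by (rule LIMSEQ_inverse_real_of_nat)
  have "\<exists>s t s' t'. (0 < s \<and> s < h n \<and> 0 < t \<and> t < h n) \<and> (0 < s' \<and> s' < h n \<and> 0 < t' \<and> t' < h n)
    \<and> DA (p + s *\<^sub>R a + t *\<^sub>R b) b = DB (p + s' *\<^sub>R b + t' *\<^sub>R a) a" for n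
  proof -
    from second_difference_mean_value[OF D A(1) h, of n p b] obtain s t where
      1: "0 < s" "s < h n" "0 < t" "t < h n"
      "f (p + h n *\<^sub>R a + h n *\<^sub>R b) - f (p + h n *\<^sub>R a) - f (p + h n *\<^sub>R b) + f p
        = (h n)\<^sup>2 * DA (p + s *\<^sub>R a + t *\<^sub>R b) b" by blast
    from second_difference_mean_value[OF D B(1) h, of n p a] obtain s' t' where
      2: "0 < s'" "s' < h n" "0 < t'" "t' < h n"
      "f (p + h n *\<^sub>R b + h n *\<^sub>R a) - f (p + h n *\<^sub>R b) - f (p + h n *\<^sub>R a) + f p
        = (h n)\<^sup>2 * DB (p + s' *\<^sub>R b + t' *\<^sub>R a) a" by blast
    have "(h n)\<^sup>2 * DA (p + s *\<^sub>R a + t *\<^sub>R b) b = (h n)\<^sup>2 * DB (p + s' *\<^sub>R b + t' *\<^sub>R a) a"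
      using 1(5) 2(5) by (simp add: algebra_simps)
    with 1 2 h[of n] show ?thesis
      by (intro exI[of _ s] exI[of _ t] exI[of _ s'] exI[of _ t']) auto
  qed
  then obtain s t s' t' where st: "\<And>n. 0 < s n \<and> s n < h n \<and> 0 < t n \<and> t n < h n"
    "\<And>n. 0 < s' n \<and> s' n < h n \<and> 0 < t' n \<and> t' n < h n"
    and eq: "\<And>n. DA (p + s n *\<^sub>R a + t n *\<^sub>R b) b = DB (p + s' n *\<^sub>R b + t' n *\<^sub>R a) a"
    by metis
  have lim: "u \<longlonglongrightarrow> 0" if "\<And>n. 0 < u n \<and> u n < h n" for u
    by (rule tendsto_sandwich[OF _ _ tendsto_const h0])
      (use that in \<open>auto intro!: always_eventually less_imp_le\<close>)
  have pts: "(\<lambda>n. p + u n *\<^sub>R c + w n *\<^sub>R d) \<longlonglongrightarrow> p"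
    if "\<And>n. 0 < u n \<and> u n < h n" "\<And>n. 0 < w n \<and> w n < h n" for u w c d
    using tendsto_add[OF tendsto_add[OF tendsto_const[of p] tendsto_scaleR[OF lim[OF that(1)] tendsto_const[of c]]]
        tendsto_scaleR[OF lim[OF that(2)] tendsto_const[of d]]] by simp
  have "(\<lambda>n. DA (p + s n *\<^sub>R a + t n *\<^sub>R b) b) \<longlonglongrightarrow> DA p b"
    using continuous_on_tendsto_compose[OF A(2) pts] st by auto
  moreover have "(\<lambda>n. DB (p + s' n *\<^sub>R b + t' n *\<^sub>R a) a) \<longlonglongrightarrow> DB p a"
    using continuous_on_tendsto_compose[OF B(2) pts] st by auto
  ultimately show ?thesis
    unfolding eq by (rule LIMSEQ_unique)
qed

lemma mixed_second_derivatives_commute: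
  fixes f :: "'a::real_normed_vector \<Rightarrow> 'b::euclidean_space"
  assumes "C_diff (Suc 1) f"
  shows "frechet_derivative (\<lambda>x. frechet_derivative f (at x) a) (at p) b =
    frechet_derivative (\<lambda>x. frechet_derivative f (at x) b) (at p) a"
proof (rule euclidean_eqI)
  fix i :: 'b assume "i \<in> Basis"
  let ?D = "\<lambda>x. frechet_derivative f (at x)"
  have D: "(f has_derivative ?D x) (at x)" for x
    using assms by (simp add: frechet_derivative_works)
  have C1: "C1 (\<lambda>x. ?D x v)" for v
    using assms by (simp add: C1_def)
  have 1: "((\<lambda>x. f x \<bullet> i) has_derivative (\<lambda>v. ?D x v \<bullet> i)) (at x)" for x
    by (rule has_derivative_inner_left[OF D])
  have 2: "((\<lambda>x. ?D x v \<bullet> i) has_derivative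
      (\<lambda>w. frechet_derivative (\<lambda>x. ?D x v) (at x) w \<bullet> i)) (at x)" for x v
    by (rule has_derivative_inner_left[OF C1_has_derivative[OF C1]])
  have 3: "continuous_on UNIV (\<lambda>x. frechet_derivative (\<lambda>x. ?D x v) (at x) w \<bullet> i)" for v w
    by (intro continuous_intros C1_continuous_derivative[OF C1])
  show "frechet_derivative (\<lambda>x. ?D x a) (at p) b \<bullet> i
     = frechet_derivative (\<lambda>x. ?D x b) (at p) a \<bullet> i"
    by (rule mixed_second_derivatives_commute_real[OF 1 2 3 2 3])
qed

section \<open>The group in exponential coordinates\<close>

text \<open>A linear model of the quotient by \<open>I\<close>. The residue \<open>x - P x\<close> lies in \<open>I\<close>, so \<open>P x\<close> is also a
  representative of the class of \<open>x\<close>.\<close>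

lemma linear_projection_off_subspace:
  fixes I :: "'a::euclidean_space set"
  assumes "subspace I"
  obtains P :: "'a \<Rightarrow> 'a" where "linear P" "\<And>x. P x = 0 \<longleftrightarrow> x \<in> I" "\<And>x. x - P x \<in> I"
proof -
  obtain B where B: "B \<subseteq> I" "pairwise orthogonal B" "\<And>x. x \<in> B \<Longrightarrow> norm x = 1"
    "independent B" "span B = I"
    using orthonormal_basis_subspace[OF assms] by metis
  define P where "P x = x - (\<Sum>b\<in>B. (b \<bullet> x / (b \<bullet> b)) *\<^sub>R b)" for x
  have sum: "(\<Sum>b\<in>B. (b \<bullet> x / (b \<bullet> b)) *\<^sub>R b) \<in> I" for x
    using B(1) by (intro subspace_sum subspace_scale assms) auto
  have orth: "orthogonal y (P x)" if "y \<in> I" for x y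
    unfolding P_def by (rule Gram_Schmidt_step[OF B(2)]) (simp add: B(5) that)
  show thesis
  proof
    show "linear P"
      unfolding P_def
      by (rule linearI)
        (simp_all add: inner_add_right add_divide_distrib scaleR_add_left sum.distrib scaleR_diff_right
          scaleR_sum_right)
    show "x - P x \<in> I" for x using sum by (simp add: P_def)
    show "P x = 0 \<longleftrightarrow> x \<in> I" for x
    proof
      assume "P x = 0"
      then show "x \<in> I" using sum[of x] by (simp add: P_def)
    next
      assume "x \<in> I"
      then have "P x \<in> I" using sum assms unfolding P_def by (intro subspace_diff) auto
      then show "P x = 0" using orth by (metis orthogonal_self)
    qed
  qed
qed

text \<open>Halving repeatedly gives \<open>f 1 = 2 ^ n *\<^sub>R f (1 / 2 ^ n)\<close>, a difference quotient at \<open>0\<close>. This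
  replaces the uniqueness of one-parameter subgroups.\<close>

lemma vector_derivative_of_doubling_map:
  fixes f :: "real \<Rightarrow> 'a::real_normed_vector"
  assumes double: "\<And>s. f (2 * s) = 2 *\<^sub>R f s" and D: "(f has_vector_derivative D) (at 0)"
  shows "f 1 = D"
proof -
  have pow: "f 1 = (2 ^ n) *\<^sub>R f (1 / 2 ^ n)" for n
  proof (induction n)
    case (Suc n)
    have "f (1 / 2 ^ n) = 2 *\<^sub>R f (1 / 2 ^ Suc n)"
      using double[of "1 / 2 ^ Suc n"] by simp
    with Suc show ?case by simp
  qed simp
  have f0: "f 0 = 0" using double[of 0] by (simp add: scaleR_2)
  have lim: "(\<lambda>h. norm (f (0 + h) - f 0 - h *\<^sub>R D) / norm h) \<midarrow>0\<rightarrow> 0"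
    using D unfolding has_vector_derivative_def has_derivative_at by blast
  have "filterlim (\<lambda>n. 1 / 2 ^ n :: real) (at 0) sequentially"
    unfolding filterlim_at using LIMSEQ_inverse_realpow_zero[of 2] by (auto simp: inverse_eq_divide)
  from filterlim_compose[OF lim this]
  have "(\<lambda>n. norm (f (1 / 2 ^ n) - (1 / 2 ^ n) *\<^sub>R D) / (1 / 2 ^ n)) \<longlonglongrightarrow> 0"
    by (simp add: f0)
  moreover have "norm (f (1 / 2 ^ n) - (1 / 2 ^ n) *\<^sub>R D) / (1 / 2 ^ n) = norm (f 1 - D)" for n
  proof -
    have "norm (f 1 - D) = norm ((2 ^ n) *\<^sub>R (f (1 / 2 ^ n) - (1 / 2 ^ n) *\<^sub>R D))"
      by (simp add: pow[of n] scaleR_diff_right)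
    then show ?thesis by (simp add: mult.commute)
  qed
  ultimately show ?thesis by (simp add: LIMSEQ_const_iff)
qed

context nilpotent_group
begin

interpretation grp: Groups.group gmult 0 uminus
  by (rule group)

definition "dmult p = frechet_derivative (\<lambda>(x, y). gmult x y) (at p)"

lemma C2_mult: "C_diff (Suc 1) (\<lambda>(x, y). gmult x y)"
  using smooth_mult unfolding smooth_def by blast

lemma C1_dmult: "C1 (\<lambda>p. dmult p w)"
  using C2_mult unfolding C1_def dmult_def C_diff.simps(2)[of 1] by blast

lemma mult_has_derivative_dmult: "((\<lambda>(x, y). gmult x y) has_derivative dmult p) (at p)"
  using C2_mult unfolding dmult_def C_diff.simps(2)[of 1] frechet_derivative_works by blast

lemma linear_dmult: "linear (dmult p)"
  using mult_has_derivative_dmult has_derivative_linear by blast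

lemma has_derivative_gmult:
  assumes "(f has_derivative f') (at t)" "(h has_derivative h') (at t)"
  shows "((\<lambda>t. gmult (f t) (h t)) has_derivative (\<lambda>s. dmult (f t, h t) (f' s, h' s))) (at t)"
  using has_derivative_compose[OF has_derivative_Pair[OF assms] mult_has_derivative_dmult] by simp

lemma dmult_first: "dmult (x, 0) (v, 0) = v"
proof -
  have "((\<lambda>t. gmult t 0) has_derivative (\<lambda>s. dmult (x, 0) (s, 0))) (at x)"
    by (rule has_derivative_gmult[OF has_derivative_ident has_derivative_const])
  then have "((\<lambda>t. t) has_derivative (\<lambda>s. dmult (x, 0) (s, 0))) (at x)"
    by simp
  from has_derivative_unique[OF this has_derivative_ident] show ?thesis
    by (simp add: fun_eq_iff)
qed

lemma left_field_eq_dmult: "left_field gmult u x = dmult (x, 0) (0, u)"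
proof -
  have "(gmult x has_derivative (\<lambda>s. dmult (x, 0) (0, s))) (at 0)"
    by (rule has_derivative_gmult[OF has_derivative_const has_derivative_ident])
  from frechet_derivative_at[OF this] show ?thesis
    by (simp add: left_field_def fun_eq_iff)
qed

lemma left_field_0: "left_field gmult u 0 = u"
proof -
  have "gmult 0 = (\<lambda>x. x)" by (rule ext) simp
  then show ?thesis by (simp add: left_field_def)
qed

lemma C1_left_field: "C1 (left_field gmult u)"
proof (rule C1I)
  have fd: "((\<lambda>x. (x, 0)) has_derivative (\<lambda>v. (v, 0))) (at x)" for x :: "'d point"
    by (auto intro!: derivative_eq_intros)
  show "(left_field gmult u has_derivative
      (\<lambda>v. frechet_derivative (\<lambda>p. dmult p (0, u)) (at (x, 0)) (v, 0))) (at x)" for x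
    unfolding left_field_eq_dmult[abs_def]
    by (rule has_derivative_compose[OF fd C1_has_derivative[OF C1_dmult]])
  show "continuous_on UNIV (\<lambda>x. frechet_derivative (\<lambda>p. dmult p (0, u)) (at (x, 0)) (v, 0))" for v
    by (rule continuous_on_compose2[OF C1_continuous_derivative[OF C1_dmult]])
      (auto intro!: continuous_intros)
qed

lemma lie_bracket_alt:
  "lie_bracket gmult u v = frechet_derivative (left_field gmult v) (at 0) u
     - frechet_derivative (left_field gmult u) (at 0) v"
  by (simp add: lie_bracket_def vfield_bracket_def left_field_0)

lemma frechet_derivative_left_field_0:
  "frechet_derivative (left_field gmult u) (at 0) v
     = frechet_derivative (\<lambda>p. dmult p (0, u)) (at 0) (v, 0)"
proof -
  have fd: "((\<lambda>x. (x, 0)) has_derivative (\<lambda>v. (v, 0))) (at x)" for x :: "'d point"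
    by (auto intro!: derivative_eq_intros)
  have "(left_field gmult u has_derivative
      (\<lambda>v. frechet_derivative (\<lambda>p. dmult p (0, u)) (at (0, 0)) (v, 0))) (at 0)"
    unfolding left_field_eq_dmult[abs_def]
    by (rule has_derivative_compose[OF fd C1_has_derivative[OF C1_dmult]])
  from frechet_derivative_at[OF this] show ?thesis
    by (simp add: zero_prod_def fun_eq_iff)
qed

lemma square_eq_double: "gmult x x = 2 *\<^sub>R x"
  using exponential[of 1 x 1] by simp

definition conj_by where "conj_by a y = gmult (gmult a y) (- a)"

lemma conj_by_mult: "conj_by a (gmult x y) = gmult (conj_by a x) (conj_by a y)"
proof -
  have "gmult (- a) (gmult a w) = w" for w
    by (metis grp.assoc grp.left_inverse grp.left_neutral)
  then show ?thesis unfolding conj_by_def by (simp add: grp.assoc)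
qed

lemma conj_by_conj_by: "conj_by a (conj_by b y) = conj_by (gmult a b) y"
  unfolding conj_by_def by (simp add: grp.assoc grp.inverse_distrib_swap)

lemma mult_eq_conj_by: "gmult a y = gmult (conj_by a y) a"
  unfolding conj_by_def by (simp add: grp.assoc)

lemma has_derivative_conj_by:
  "(conj_by a has_derivative (\<lambda>v. dmult (gmult a y, - a) (dmult (a, y) (0, v), 0))) (at y)"
  unfolding conj_by_def[abs_def]
  by (intro has_derivative_gmult has_derivative_const has_derivative_ident)

text \<open>In exponential coordinates squaring is doubling, so a conjugation, being an automorphism,
  commutes with doubling and hence coincides with its derivative at the neutral element.\<close>

lemma linear_conj_by: "linear (conj_by a)"
proof -
  let ?D = "\<lambda>v. dmult (gmult a 0, - a) (dmult (a, 0) (0, v), 0)"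
  have D: "(conj_by a has_derivative ?D) (at 0)"
    by (rule has_derivative_conj_by)
  have "conj_by a y = ?D y" for y
  proof -
    have "conj_by a ((2 * s) *\<^sub>R y) = 2 *\<^sub>R conj_by a (s *\<^sub>R y)" for s
      using conj_by_mult[of a "s *\<^sub>R y" "s *\<^sub>R y"] by (simp add: square_eq_double)
    moreover have "((\<lambda>s. conj_by a (s *\<^sub>R y)) has_vector_derivative ?D y) (at 0)"
    proof -
      have l: "((\<lambda>s. s *\<^sub>R y) has_derivative (\<lambda>s. s *\<^sub>R y)) (at (0::real))"
        by (auto intro!: derivative_eq_intros)
      have "((\<lambda>s. conj_by a (s *\<^sub>R y)) has_derivative (\<lambda>s. ?D (s *\<^sub>R y))) (at 0)"
        using has_derivative_compose[OF l, of "conj_by a" ?D] D by simp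
      then show ?thesis
        unfolding has_vector_derivative_def
        using linear_scale[OF has_derivative_linear[OF D]] by simp
    qed
    ultimately show ?thesis
      using vector_derivative_of_doubling_map[of "\<lambda>s. conj_by a (s *\<^sub>R y)" "?D y"] by simp
  qed
  then have "conj_by a = ?D" by (rule ext)
  with has_derivative_linear[OF D] show ?thesis by simp
qed

text \<open>Being linear, \<open>conj_by\<close> is the adjoint action of the group, and this is its infinitesimal
  form. The chain rule gives the velocity as the difference of the right- and the left-invariant field
  of \<open>z\<close> at \<open>u\<close>.\<close>

lemma conj_by_velocity:
  "((\<lambda>t. conj_by (t *\<^sub>R z) u) has_vector_derivative - lie_bracket gmult u z) (at 0)"
proof -
  define A where "A u = dmult (0, u) (z, 0) - left_field gmult z u" for u
  have A: "((\<lambda>t. conj_by (t *\<^sub>R z) u) has_vector_derivative A u) (at 0)" for u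
  proof -
    have l: "((\<lambda>t. t *\<^sub>R z) has_derivative (\<lambda>s. s *\<^sub>R z)) (at (0::real))"
      by (auto intro!: derivative_eq_intros)
    have "((\<lambda>t. conj_by (t *\<^sub>R z) u) has_derivative
       (\<lambda>s. dmult (gmult (0 *\<^sub>R z) u, - (0 *\<^sub>R z)) (dmult (0 *\<^sub>R z, u) (s *\<^sub>R z, 0), - (s *\<^sub>R z)))) (at 0)"
      unfolding conj_by_def
      by (intro has_derivative_gmult has_derivative_const l has_derivative_minus)
    also have "(\<lambda>s. dmult (gmult (0 *\<^sub>R z) u, - (0 *\<^sub>R z)) (dmult (0 *\<^sub>R z, u) (s *\<^sub>R z, 0), - (s *\<^sub>R z)))
      = (\<lambda>s. s *\<^sub>R A u)"
    proof
      fix s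
      have "dmult (u, 0) (dmult (0, u) (s *\<^sub>R z, 0), - (s *\<^sub>R z))
        = dmult (u, 0) ((dmult (0, u) (s *\<^sub>R z, 0), 0) - (0, s *\<^sub>R z))"
        by simp
      also have "\<dots> = dmult (0, u) (s *\<^sub>R (z, 0)) - dmult (u, 0) (s *\<^sub>R (0, z))"
        by (subst linear_diff[OF linear_dmult]) (simp add: dmult_first)
      also have "\<dots> = s *\<^sub>R A u"
        by (simp only: linear_scale[OF linear_dmult] A_def left_field_eq_dmult scaleR_diff_right)
      finally show "dmult (gmult (0 *\<^sub>R z) u, - (0 *\<^sub>R z)) (dmult (0 *\<^sub>R z, u) (s *\<^sub>R z, 0), - (s *\<^sub>R z))
        = s *\<^sub>R A u" by simp
    qed
    finally show ?thesis unfolding has_vector_derivative_def .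
  qed
  have scale: "A (s *\<^sub>R u) = s *\<^sub>R A u" for s u
  proof (rule vector_derivative_unique_at[OF A])
    show "((\<lambda>t. conj_by (t *\<^sub>R z) (s *\<^sub>R u)) has_vector_derivative s *\<^sub>R A u) (at 0)"
      unfolding linear_scale[OF linear_conj_by]
      using bounded_linear.has_vector_derivative[OF bounded_linear_scaleR_right A] .
  qed
  \<comment> \<open>A homogeneous differentiable map is its own derivative at the origin; computing that
    derivative of \<open>A\<close> and exchanging the second derivatives of the product gives the bracket.\<close>
  have fd: "((\<lambda>x. (0, x)) has_derivative (\<lambda>v. (0, v))) (at x)" for x :: "'d point"
    by (auto intro!: derivative_eq_intros)
  have "((\<lambda>x. dmult (0, x) (z, 0)) has_derivative
      (\<lambda>v. frechet_derivative (\<lambda>p. dmult p (z, 0)) (at (0, 0)) (0, v))) (at 0)"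
    by (rule has_derivative_compose[OF fd C1_has_derivative[OF C1_dmult]])
  then have dA: "(A has_derivative (\<lambda>v. frechet_derivative (\<lambda>p. dmult p (z, 0)) (at 0) (0, v)
      - frechet_derivative (left_field gmult z) (at 0) v)) (at 0)" (is "(_ has_derivative ?A') _")
    unfolding A_def zero_prod_def
    by (rule has_derivative_diff[OF _ C1_has_derivative[OF C1_left_field]])
  have "((\<lambda>s. A (s *\<^sub>R u)) has_derivative (\<lambda>s. ?A' (s *\<^sub>R u))) (at 0)"
  proof -
    have l: "((\<lambda>s. s *\<^sub>R u) has_derivative (\<lambda>s. s *\<^sub>R u)) (at (0::real))"
      by (auto intro!: derivative_eq_intros)
    show ?thesis using has_derivative_compose[OF l, of A ?A'] dA by simp
  qed
  moreover have "((\<lambda>s. A (s *\<^sub>R u)) has_derivative (\<lambda>s. s *\<^sub>R A u)) (at 0)"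
    unfolding scale by (auto intro!: derivative_eq_intros)
  ultimately have "(\<lambda>s::real. ?A' (s *\<^sub>R u)) = (\<lambda>s. s *\<^sub>R A u)"
    by (rule has_derivative_unique)
  from fun_cong[OF this, of 1] have "A u = ?A' u" by simp
  also have "frechet_derivative (\<lambda>p. dmult p (z, 0)) (at 0) (0, u)
    = frechet_derivative (\<lambda>p. dmult p (0, u)) (at 0) (z, 0)"
    unfolding dmult_def by (rule mixed_second_derivatives_commute[OF C2_mult])
  finally have "A u = - lie_bracket gmult u z"
    by (simp add: lie_bracket_alt frechet_derivative_left_field_0)
  with A[of u] show ?thesis by simp
qed

text \<open>A linear map \<open>P\<close> stands for the quotient by its kernel. By the group law of \<open>t \<mapsto> t *\<^sub>R z\<close> the
  velocity of \<open>t \<mapsto> conj_by (t *\<^sub>R z) u\<close> is a bracket with \<open>z\<close> at every time, so \<open>P\<close> does not see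
  the motion.\<close>

lemma conj_by_modulo:
  fixes P :: "'d point \<Rightarrow> 'b::euclidean_space"
  assumes P: "linear P" and cen: "\<And>u. P (lie_bracket gmult u z) = 0"
  shows "P (conj_by (t *\<^sub>R z) u) = P u"
proof -
  have bl: "bounded_linear P" using P by (simp add: linear_conv_bounded_linear)
  have D: "((\<lambda>t. P (conj_by (t *\<^sub>R z) u)) has_vector_derivative 0) (at t)" for t
  proof -
    define w where "w = conj_by (t *\<^sub>R z) u"
    have "P (- lie_bracket gmult w z) = 0"
      by (subst linear_neg[OF P]) (simp add: cen)
    then have "((\<lambda>h. P (conj_by (h *\<^sub>R z) w)) has_vector_derivative 0) (at (t - t))"
      using bounded_linear.has_vector_derivative[OF bl conj_by_velocity[of z w]] by simp
    then have "((\<lambda>h. P (conj_by (h *\<^sub>R z) w)) \<circ> (\<lambda>s. s - t) has_vector_derivative (1 *\<^sub>R 0)) (at t)"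
      by (intro vector_diff_chain_at) (auto intro!: derivative_eq_intros)
    moreover have "(\<lambda>h. P (conj_by (h *\<^sub>R z) w)) \<circ> (\<lambda>s. s - t) = (\<lambda>s. P (conj_by (s *\<^sub>R z) u))"
      unfolding w_def conj_by_conj_by exponential by (simp add: o_def)
    ultimately show ?thesis by simp
  qed
  obtain c where c: "\<And>t. t \<in> UNIV \<Longrightarrow> P (conj_by (t *\<^sub>R z) u) = c"
    using has_vector_derivative_zero_constant[of UNIV "\<lambda>t. P (conj_by (t *\<^sub>R z) u)", OF convex_UNIV D] by blast
  have "conj_by (0 *\<^sub>R z) u = u" by (simp add: conj_by_def)
  with c[OF UNIV_I, of t] c[OF UNIV_I, of 0] show ?thesis by metis
qed

text \<open>Modulo the kernel of \<open>P\<close> the multiples of \<open>z\<close> commute with everything, so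
  \<open>s \<mapsto> gmult (s *\<^sub>R z) (s *\<^sub>R y)\<close> commutes with doubling and equals its velocity \<open>z + y\<close>.\<close>

lemma mult_central_modulo:
  fixes P :: "'d point \<Rightarrow> 'b::euclidean_space"
  assumes P: "linear P" and cen: "\<And>u. P (lie_bracket gmult u z) = 0"
    and comp: "\<And>x x' y y'. P x = P x' \<Longrightarrow> P y = P y' \<Longrightarrow> P (gmult x y) = P (gmult x' y')"
  shows "P (gmult z y) = P (z + y)" and "P (gmult y z) = P (z + y)"
proof -
  have comm: "P (gmult (t *\<^sub>R z) u) = P (gmult u (t *\<^sub>R z))" for t u
    using comp[OF conj_by_modulo[OF P cen] refl, of t u "t *\<^sub>R z"]
    by (simp only: mult_eq_conj_by[of "t *\<^sub>R z" u])
  define k where "k s = P (gmult (s *\<^sub>R z) (s *\<^sub>R y))" for s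
  have "k (2 * s) = 2 *\<^sub>R k s" for s
  proof -
    let ?z = "s *\<^sub>R z" and ?y = "s *\<^sub>R y"
    have "k (2 * s) = P (gmult (gmult ?z ?z) (gmult ?y ?y))"
      by (simp add: k_def square_eq_double)
    also have "\<dots> = P (gmult (gmult ?z (gmult ?z ?y)) ?y)"
      by (simp add: grp.assoc)
    also have "\<dots> = P (gmult (gmult ?z (gmult ?y ?z)) ?y)"
      by (rule comp[OF comp[OF refl comm] refl])
    also have "\<dots> = P (gmult (gmult ?z ?y) (gmult ?z ?y))"
      by (simp add: grp.assoc)
    finally show ?thesis by (simp add: k_def square_eq_double linear_scale[OF P])
  qed
  moreover have "(k has_vector_derivative P (z + y)) (at 0)"
  proof -
    have l: "((\<lambda>s. s *\<^sub>R u) has_derivative (\<lambda>s. s *\<^sub>R u)) (at (0::real))" for u :: "'d point"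
      by (auto intro!: derivative_eq_intros)
    have "((\<lambda>s. gmult (s *\<^sub>R z) (s *\<^sub>R y)) has_derivative
       (\<lambda>s. dmult (0 *\<^sub>R z, 0 *\<^sub>R y) (s *\<^sub>R z, s *\<^sub>R y))) (at 0)"
      by (intro has_derivative_gmult l)
    also have "(\<lambda>s. dmult (0 *\<^sub>R z, 0 *\<^sub>R y) (s *\<^sub>R z, s *\<^sub>R y)) = (\<lambda>s. s *\<^sub>R (z + y))"
    proof
      fix s
      have "dmult (0, 0) (z, y) = dmult (0, 0) ((z, 0) + (0, y))" by simp
      also have "\<dots> = z + y"
        by (subst linear_add[OF linear_dmult])
          (simp add: dmult_first left_field_eq_dmult[symmetric] left_field_0)
      finally show "dmult (0 *\<^sub>R z, 0 *\<^sub>R y) (s *\<^sub>R z, s *\<^sub>R y) = s *\<^sub>R (z + y)"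
        using linear_scale[OF linear_dmult, of "(0,0)" s "(z, y)"] by simp
    qed
    finally have D: "((\<lambda>s. gmult (s *\<^sub>R z) (s *\<^sub>R y)) has_vector_derivative z + y) (at 0)"
      by (simp add: has_vector_derivative_def)
    have "bounded_linear P" using P by (simp add: linear_conv_bounded_linear)
    from bounded_linear.has_vector_derivative[OF this D] show ?thesis
      by (simp add: k_def[abs_def])
  qed
  ultimately have "k 1 = P (z + y)" by (rule vector_derivative_of_doubling_map)
  then show "P (gmult z y) = P (z + y)" by (simp add: k_def)
  with comm[of 1 y] show "P (gmult y z) = P (z + y)" by simp
qed

lemma subspace_lower_central: "subspace (lower_central gmult i)"
  by (cases i) (simp_all add: bracket_span_def)

lemma lie_bracket_in_lower_central:
  "z \<in> lower_central gmult i \<Longrightarrow> lie_bracket gmult u z \<in> lower_central gmult (Suc i)"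
  unfolding lower_central.simps bracket_span_def by (rule span_base) blast

lemma lower_central_Suc_subset: "lower_central gmult (Suc i) \<subseteq> lower_central gmult i"
proof (induction i)
  case (Suc i)
  show ?case
    unfolding lower_central.simps(2)[of _ "Suc i"] bracket_span_def
  proof (rule span_minimal[OF _ subspace_lower_central], safe)
    fix u v assume "v \<in> lower_central gmult (Suc i)"
    with Suc have "v \<in> lower_central gmult i" by blast
    then show "lie_bracket gmult u v \<in> lower_central gmult (Suc i)"
      by (rule lie_bracket_in_lower_central)
  qed
qed simp

definition mult_descends :: "'d point set \<Rightarrow> bool" where
  "mult_descends I \<longleftrightarrow> (\<forall>x y z z'. z \<in> I \<longrightarrow> z' \<in> I \<longrightarrow> gmult (x + z) (y + z') - gmult x y \<in> I)"

lemma mult_translate_modulo: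
  assumes I: "subspace I" "mult_descends I" and cen: "\<And>u. lie_bracket gmult u z \<in> I"
  shows "gmult (x + z) y - (gmult x y + z) \<in> I" and "gmult x (y + z) - (gmult x y + z) \<in> I"
proof -
  obtain P where P: "linear P" "\<And>x. P x = 0 \<longleftrightarrow> x \<in> I" "\<And>x. x - P x \<in> I"
    by (rule linear_projection_off_subspace[OF I(1)]) (rule that)
  have eq: "P x = P y \<longleftrightarrow> x - y \<in> I" for x y
    using P(2)[of "x - y"] by (simp add: linear_diff[OF P(1)])
  have comp: "P (gmult x y) = P (gmult x' y')" if "P x = P x'" "P y = P y'" for x x' y y'
    using I(2)[unfolded mult_descends_def, rule_format, of "x - x'" "y - y'" x' y'] that
    by (simp add: eq)
  have cen': "P (lie_bracket gmult u z) = 0" for u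
    using cen P(2) by blast
  have central: "P (gmult z y) = P (z + y)" "P (gmult y z) = P (z + y)" for y
    by (rule mult_central_modulo[OF P(1) cen']; rule comp; assumption)+
  have "P (gmult (x + z) y) = P (gmult (gmult z x) y)"
    by (rule comp) (simp_all only: central add.commute)
  also have "\<dots> = P (gmult x y + z)"
    by (simp only: grp.assoc central add.commute)
  finally show "gmult (x + z) y - (gmult x y + z) \<in> I" by (simp only: eq)
  have "P (gmult x (y + z)) = P (gmult x (gmult y z))"
    by (rule comp) (simp_all only: central add.commute)
  also have "\<dots> = P (gmult (gmult x y) z)"
    by (simp only: grp.assoc)
  also have "\<dots> = P (gmult x y + z)"
    by (simp only: central add.commute)
  finally show "gmult x (y + z) - (gmult x y + z) \<in> I" by (simp only: eq)
qed

text \<open>Downward induction from the trivial term: if the product descends modulo one term, then the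
  elements of the preceding term are central modulo it, and translating either factor by such an
  element translates the product by it.\<close>

lemma mult_descends_lower_central:
  assumes r: "lower_central gmult r = {0}" and "i \<le> r"
  shows "mult_descends (lower_central gmult i)"
  using \<open>i \<le> r\<close>
proof (induction rule: inc_induct)
  case base
  show ?case by (simp add: r mult_descends_def)
next
  case (step i)
  note sub = subspace_lower_central[of "Suc i"] and sub' = subspace_lower_central[of i]
  show ?case
    unfolding mult_descends_def
  proof (intro allI impI)
    fix x y z z' assume z: "z \<in> lower_central gmult i" "z' \<in> lower_central gmult i"
    have cen: "lie_bracket gmult u w \<in> lower_central gmult (Suc i)"
      if "w \<in> lower_central gmult i" for u w
      using that by (rule lie_bracket_in_lower_central)
    note mult_translate_modulo[OF sub step.IH cen[OF z(1)], THEN subsetD[OF lower_central_Suc_subset]]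
      mult_translate_modulo[OF sub step.IH cen[OF z(2)], THEN subsetD[OF lower_central_Suc_subset]]
    then have "(gmult (x + z) (y + z') - (gmult x (y + z') + z)) + (gmult x (y + z') - (gmult x y + z'))
        + (z + z') \<in> lower_central gmult i"
      by (intro subspace_add[OF sub'] z)
    also have "(gmult (x + z) (y + z') - (gmult x (y + z') + z)) + (gmult x (y + z') - (gmult x y + z'))
        + (z + z') = gmult (x + z) (y + z') - gmult x y"
      by (simp add: algebra_simps)
    finally show "gmult (x + z) (y + z') - gmult x y \<in> lower_central gmult i" .
  qed
qed

lemma mult_translate_modulo_lower_central:
  assumes "lower_central gmult r = {0}" "i < r" "z \<in> lower_central gmult i"
  shows "gmult (x + z) y - (gmult x y + z) \<in> lower_central gmult (Suc i)"
proof (rule mult_translate_modulo(1)[OF subspace_lower_central])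
  show "mult_descends (lower_central gmult (Suc i))"
    using assms(2) by (intro mult_descends_lower_central[OF assms(1)] Suc_leI)
  show "lie_bracket gmult u z \<in> lower_central gmult (Suc i)" for u
    using assms(3) by (rule lie_bracket_in_lower_central)
qed

text \<open>Translating the base point by \<open>z\<close> shifts \<open>y \<mapsto> gmult x y\<close> by the constant \<open>z\<close>, modulo the
  next term of the series, and so leaves its derivative at \<open>0\<close> unchanged.\<close>

lemma left_field_modulo_lower_central:
  assumes "lower_central gmult r = {0}" "i < r" "z \<in> lower_central gmult i"
  shows "left_field gmult u (x + z) - left_field gmult u x \<in> lower_central gmult (Suc i)"
proof -
  obtain P where P: "linear P" "\<And>x. P x = 0 \<longleftrightarrow> x \<in> lower_central gmult (Suc i)"
      "\<And>x. x - P x \<in> lower_central gmult (Suc i)"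
    by (rule linear_projection_off_subspace[OF subspace_lower_central[of "Suc i"]]) (rule that)
  have bl: "bounded_linear P" using P(1) by (simp add: linear_conv_bounded_linear)
  have D: "((\<lambda>y. P (gmult x y)) has_derivative (\<lambda>v. P (dmult (x, 0) (0, v)))) (at 0)" for x
    by (rule bounded_linear.has_derivative[OF bl])
      (rule has_derivative_gmult[OF has_derivative_const has_derivative_ident])
  have "P (gmult (x + z) y) = P (gmult x y) + P z" for y
    using iffD2[OF P(2) mult_translate_modulo_lower_central[OF assms]]
    by (simp add: linear_diff[OF P(1)] linear_add[OF P(1)])
  then have "((\<lambda>y. P (gmult (x + z) y)) has_derivative (\<lambda>v. P (dmult (x, 0) (0, v)))) (at 0)"
    using has_derivative_add[OF D[of x] has_derivative_const[of "P z"]] by simp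
  from fun_cong[OF has_derivative_unique[OF this D], of u]
  have "P (left_field gmult u (x + z)) = P (left_field gmult u x)"
    by (simp add: left_field_eq_dmult)
  then show ?thesis
    unfolding P(2)[symmetric] by (simp add: linear_diff[OF P(1)])
qed

text \<open>Any nonzero vector of the last nontrivial term of the lower central series will do.\<close>

lemma central_direction:
  obtains z where "norm z = 1" "\<And>t y. gmult (t *\<^sub>R z) y = t *\<^sub>R z + y"
proof -
  define r where "r = nilpotency_step gmult"
  have ex: "\<exists>r. lower_central gmult r = {0}"
    using nilpotent by (simp add: lie_nilpotent_def)
  have r: "lower_central gmult r = {0}"
    unfolding r_def nilpotency_step_def by (rule LeastI_ex[OF ex])
  have "r \<noteq> 0"
  proof
    assume "r = 0"
    with r have "(axis i 1 :: 'd point) \<in> {0}" for i by simp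
    then show False by (simp add: axis_eq_0_iff)
  qed
  then obtain k where k: "r = Suc k" using not0_implies_Suc by blast
  have "lower_central gmult k \<noteq> {0}"
    using not_less_Least[of k "\<lambda>r. lower_central gmult r = {0}"] k
    unfolding r_def nilpotency_step_def by auto
  then obtain z where z: "z \<in> lower_central gmult k" "z \<noteq> 0"
    using subspace_0[OF subspace_lower_central[of k]] by blast
  have eq: "gmult (t *\<^sub>R z) y = t *\<^sub>R z + y" for t y
  proof -
    have "t *\<^sub>R z \<in> lower_central gmult k"
      by (rule subspace_scale[OF subspace_lower_central z(1)])
    have "gmult (0 + t *\<^sub>R z) y - (gmult 0 y + t *\<^sub>R z) \<in> lower_central gmult (Suc k)"
      by (rule mult_translate_modulo_lower_central[OF r]) (use k \<open>t *\<^sub>R z \<in> _\<close> in auto)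
    then have "gmult (0 + t *\<^sub>R z) y - (gmult 0 y + t *\<^sub>R z) \<in> {0}"
      by (simp only: k[symmetric] r)
    then show ?thesis by (simp add: add.commute)
  qed
  show thesis
  proof
    show "norm (z /\<^sub>R norm z) = 1" using z(2) by simp
    show "gmult (t *\<^sub>R (z /\<^sub>R norm z)) y = t *\<^sub>R (z /\<^sub>R norm z) + y" for t y
      using eq[of "t / norm z" y] by (simp add: divide_inverse)
  qed
qed

end

lemma set_integral_lebesgue_translate:
  fixes f :: "'a::euclidean_space \<Rightarrow> real"
  assumes f: "integrable lebesgue f"
    and E: "E \<in> sets lebesgue"
  shows "(LINT p:(+) z ` E|lebesgue. f p) = (LINT p:E|lebesgue. f (z + p))"
proof -
  have T: "(\<lambda>x. z + (\<Sum>j\<in>Basis. (1 * (x \<bullet> j)) *\<^sub>R j)) = (+) z"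
    by (simp add: euclidean_representation)
  have meas: "(+) z \<in> lebesgue \<rightarrow>\<^sub>M lebesgue"
    using lebesgue_affine_measurable[of "\<lambda>_. 1" z] unfolding T by simp
  have eq: "(lebesgue :: 'a measure) = distr lebesgue lebesgue ((+) z)"
    using lebesgue_affine_euclidean[of "\<lambda>_. 1" z] unfolding T by (simp add: density_1)
  let ?h = "\<lambda>p. indicator ((+) z ` E) p *\<^sub>R f p"
  have "?h \<in> borel_measurable lebesgue"
    using f lebesgue_sets_translation[OF E, of z] by (intro borel_measurable_scaleR borel_measurable_indicator) auto
  then have "integral\<^sup>L (distr lebesgue lebesgue ((+) z)) ?h = integral\<^sup>L lebesgue (\<lambda>p. ?h (z + p))"
    by (rule integral_distr[OF meas])
  moreover have "(\<lambda>p. ?h (z + p)) = (\<lambda>p. indicator E p *\<^sub>R f (z + p))"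
    by (rule ext) (auto simp: indicator_def)
  ultimately show ?thesis
    unfolding set_lebesgue_integral_def eq[symmetric] by (simp only:)
qed

context sub_finsler_nilpotent_group
begin

section \<open>Horizontal vectors and admissible fields\<close>

lemma bilinear_metric: "bilinear (g p)"
  using metric(1) unfolding riemannian_metric_def by blast

lemma linear_metric: "linear (\<lambda>u. g p u v)" "linear (g p u)"
  using bilinear_metric[of p] unfolding bilinear_def by auto

lemma metric_positive: "u \<noteq> 0 \<Longrightarrow> g p u u > 0"
  using metric(1) unfolding riemannian_metric_def by blast

lemma frame_in_horizontal: "X i p \<in> horizontal X p"
  unfolding horizontal_def by (rule span_base) simp

lemma subspace_horizontal: "subspace (horizontal X p)"
  unfolding horizontal_def by (rule subspace_span)

lemma metric_frame_sum: "g p (\<Sum>i\<in>UNIV. a i *\<^sub>R X i p) (X j p) = a j"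
proof -
  have "g p (\<Sum>i\<in>UNIV. a i *\<^sub>R X i p) (X j p) = (\<Sum>i\<in>UNIV. a i * g p (X i p) (X j p))"
    by (simp add: linear_sum[OF linear_metric(1)] linear_scale[OF linear_metric(1)])
  also have "\<dots> = (\<Sum>i\<in>UNIV. if i = j then a i else 0)"
    by (intro sum.cong) (simp_all add: X_orthonormal)
  finally show ?thesis by simp
qed

lemma horizontal_frame_expansion:
  assumes "u \<in> horizontal X p"
  shows "u = (\<Sum>i\<in>UNIV. g p u (X i p) *\<^sub>R X i p)"
proof -
  have "subspace {u. u = (\<Sum>i\<in>UNIV. g p u (X i p) *\<^sub>R X i p)}"
    unfolding subspace_def
    by (auto simp: linear_0[OF linear_metric(1)] linear_add[OF linear_metric(1)]
        linear_scale[OF linear_metric(1)] scaleR_add_left sum.distrib simp flip: scaleR_scaleR scaleR_sum_right)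
  moreover have "X j p \<in> {u. u = (\<Sum>i\<in>UNIV. g p u (X i p) *\<^sub>R X i p)}" for j
    by (simp add: X_orthonormal if_distrib[of "\<lambda>c. c *\<^sub>R _"] cong: if_cong)
  ultimately show ?thesis
    using span_minimal[of "range (\<lambda>i. X i p)"] assms unfolding horizontal_def by blast
qed

lemma frame_coeffs_eq:
  assumes "u \<in> horizontal X p"
  shows "frame_coeffs X p u = (\<lambda>i. g p u (X i p))"
  unfolding frame_coeffs_def
proof (rule the_equality)
  show "u = (\<Sum>i\<in>UNIV. g p u (X i p) *\<^sub>R X i p)"
    by (rule horizontal_frame_expansion[OF assms])
  show "a = (\<lambda>i. g p u (X i p))" if "u = (\<Sum>i\<in>UNIV. a i *\<^sub>R X i p)" for a
    by (rule ext) (simp add: that metric_frame_sum)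
qed

text \<open>Left translation to the neutral element keeps the frame coefficients.\<close>

definition to_origin :: "'d point \<Rightarrow> 'd point \<Rightarrow> 'd point" where
  "to_origin p u = (\<Sum>i\<in>UNIV. g p u (X i p) *\<^sub>R X i 0)"

lemma linear_to_origin: "linear (to_origin p)"
  unfolding to_origin_def
  by (rule linearI)
    (simp_all add: linear_add[OF linear_metric(1)] linear_scale[OF linear_metric(1)]
      scaleR_add_left sum.distrib scaleR_sum_right)

lemma to_origin_horizontal: "to_origin p u \<in> horizontal X 0"
  unfolding to_origin_def
  by (intro subspace_sum subspace_scale subspace_horizontal frame_in_horizontal)

lemma zero_in_K: "0 \<in> K"
  using K_interior unfolding interior_of_def by blast

lemma K_shrink: "k \<in> K \<Longrightarrow> 0 \<le> c \<Longrightarrow> c \<le> 1 \<Longrightarrow> c *\<^sub>R k \<in> K"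
  using convexD[OF K_convex _ zero_in_K, of k c "1 - c"] by simp

text \<open>Since \<open>0\<close> is interior to \<open>K\<close> in the horizontal space, the infimum defining the gauge runs over
  a nonempty set; compactness of \<open>K\<close> covers the boundary case, where the infimum is \<open>1\<close>.\<close>

lemma gauge_le_1_iff:
  assumes w: "w \<in> horizontal X 0"
  shows "gauge K w \<le> 1 \<longleftrightarrow> w \<in> K"
proof
  let ?L = "{l::real. 0 \<le> l \<and> w \<in> (\<lambda>x. l *\<^sub>R x) ` K}"
  have bdd: "bdd_below ?L" by (rule bdd_belowI[of _ 0]) simp
  { assume "w \<in> K"
    then have "1 \<in> ?L" by simp
    then show "gauge K w \<le> 1" unfolding gauge_def by (rule cInf_lower[OF _ bdd]) }
  assume le: "gauge K w \<le> 1"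
  obtain T where T: "open T" "0 \<in> T" "T \<inter> horizontal X 0 \<subseteq> K"
    using K_interior unfolding interior_of_def openin_open by blast
  obtain e where e: "e > 0" "ball 0 e \<subseteq> T"
    using openE[OF T(1,2)] by blast
  \<comment> \<open>Dividing by \<open>l\<close> brings \<open>w\<close> into the ball of radius \<open>e\<close>.\<close>
  define l where "l = norm w / e + 1"
  have "norm w / e \<ge> 0" using e(1) by simp
  then have l: "l > 0" unfolding l_def by linarith
  have "norm (w /\<^sub>R l) < e"
    using e(1) l by (simp add: l_def divide_simps)
  then have "w /\<^sub>R l \<in> T" using e(2) by (auto simp: subset_iff)
  moreover have "w /\<^sub>R l \<in> horizontal X 0"
    by (rule subspace_scale[OF subspace_horizontal w])
  ultimately have "w /\<^sub>R l \<in> K" using T(3) by blast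
  then have "l \<in> ?L" using l by (auto intro!: image_eqI[of _ _ "w /\<^sub>R l"])
  then have ne: "?L \<noteq> {}" by blast
  have K': "w /\<^sub>R (1 + inverse (real (Suc n))) \<in> K" for n
  proof -
    define c where "c = 1 + inverse (real (Suc n))"
    have c: "c > 1" by (simp add: c_def)
    then have "Inf ?L < c" using le unfolding gauge_def by linarith
    then obtain l' k where "l' < c" "0 \<le> l'" "k \<in> K" "w = l' *\<^sub>R k"
      using cInf_lessD[OF ne] by blast
    moreover have "0 \<le> l' / c" "l' / c \<le> 1"
      using c \<open>0 \<le> l'\<close> \<open>l' < c\<close> by (auto simp: divide_simps)
    ultimately have "(l' / c) *\<^sub>R k \<in> K" by (intro K_shrink)
    then show ?thesis
      using \<open>w = l' *\<^sub>R k\<close> by (simp add: c_def divide_inverse mult.commute)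
  qed
  have "(\<lambda>n. w /\<^sub>R (1 + inverse (real (Suc n)))) \<longlonglongrightarrow> w /\<^sub>R (1 + 0)"
    by (intro tendsto_intros LIMSEQ_inverse_real_of_nat) auto
  from closed_sequentially[OF compact_imp_closed[OF K_compact] K' this]
  show "w \<in> K" by simp
qed

lemma admissible_iff:
  "U \<in> admissible_fields X K \<longleftrightarrow> C1 U \<and> compact (closure {p. U p \<noteq> 0}) \<and>
     (\<forall>p. U p \<in> horizontal X p \<and> to_origin p (U p) \<in> K)"
proof -
  have "hor_norm X K p (U p) \<le> 1 \<longleftrightarrow> to_origin p (U p) \<in> K" if "U p \<in> horizontal X p" for p
    unfolding gauge_le_1_iff[OF to_origin_horizontal, symmetric]
    by (simp add: hor_norm_def frame_coeffs_eq[OF that] to_origin_def)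
  then show ?thesis unfolding admissible_fields_def C1_def by blast
qed

lemma admissible_C1: "U \<in> admissible_fields X K \<Longrightarrow> C1 U"
  by (simp add: admissible_iff)

lemma zero_admissible: "(\<lambda>p. 0) \<in> admissible_fields X K"
  by (simp add: admissible_iff C1_const zero_in_K linear_0[OF linear_to_origin]
      subspace_0[OF subspace_horizontal])

lemma compact_support_subset:
  fixes S :: "'a::heine_borel set"
  assumes "compact (closure A)" "compact (closure B)" "S \<subseteq> A \<union> B"
  shows "compact (closure S)"
proof -
  have "bounded A" "bounded B"
    using assms(1,2) by (meson bounded_subset closure_subset compact_imp_bounded)+
  then have "bounded S" using assms(3) by (meson bounded_Un bounded_subset)
  then show ?thesis by (simp add: compact_closure)
qed

lemma admissible_blend:
  fixes \<theta> :: "'d point \<Rightarrow> real"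
  assumes U: "U \<in> admissible_fields X K" "W \<in> admissible_fields X K"
    and \<theta>: "C1 \<theta>" "\<And>p. 0 \<le> \<theta> p" "\<And>p. \<theta> p \<le> 1"
  shows "(\<lambda>p. (1 - \<theta> p) *\<^sub>R U p + \<theta> p *\<^sub>R W p) \<in> admissible_fields X K"
  unfolding admissible_iff
proof (intro conjI allI)
  show "C1 (\<lambda>p. (1 - \<theta> p) *\<^sub>R U p + \<theta> p *\<^sub>R W p)"
    by (intro C1_add C1_scaleR C1_diff C1_const \<theta>(1) U[THEN admissible_C1])
  show "compact (closure {p. (1 - \<theta> p) *\<^sub>R U p + \<theta> p *\<^sub>R W p \<noteq> 0})"
    by (rule compact_support_subset[of "{p. U p \<noteq> 0}" "{p. W p \<noteq> 0}"])
      (use U in \<open>auto simp: admissible_iff\<close>)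
  fix p
  have 1: "U p \<in> horizontal X p" "W p \<in> horizontal X p" "to_origin p (U p) \<in> K" "to_origin p (W p) \<in> K"
    using U by (auto simp: admissible_iff)
  then show "(1 - \<theta> p) *\<^sub>R U p + \<theta> p *\<^sub>R W p \<in> horizontal X p"
    by (intro subspace_add subspace_scale subspace_horizontal)
  show "to_origin p ((1 - \<theta> p) *\<^sub>R U p + \<theta> p *\<^sub>R W p) \<in> K"
    using convexD[OF K_convex 1(3,4), of "1 - \<theta> p" "\<theta> p"] \<theta>(2,3)[of p]
    by (simp add: linear_add[OF linear_to_origin] linear_scale[OF linear_to_origin])
qed

text \<open>The frame coefficients at \<open>p\<close> are those at the neutral element of a vector in the bounded set
  \<open>K\<close>, whence a bound uniform in \<open>p\<close>.\<close>

lemma bounded_frame_coefficients: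
  obtains M where "M \<ge> 0" "\<And>p u i. to_origin p u \<in> K \<Longrightarrow> \<bar>g p u (X i p)\<bar> \<le> M"
proof -
  have "\<exists>M. \<forall>w\<in>K. \<bar>g 0 w (X i 0)\<bar> \<le> M" for i
  proof -
    have "bounded ((\<lambda>w. g 0 w (X i 0)) ` K)"
      using K_compact linear_metric(1)
      by (intro bounded_linear_image compact_imp_bounded) (auto simp: linear_conv_bounded_linear)
    then show ?thesis by (auto simp: bounded_iff)
  qed
  then obtain M where M: "\<And>i w. w \<in> K \<Longrightarrow> \<bar>g 0 w (X i 0)\<bar> \<le> M i" by metis
  show thesis
  proof
    show "(\<Sum>i\<in>UNIV. \<bar>M i\<bar>) \<ge> 0" by (intro sum_nonneg) simp
    fix p u i assume "to_origin p u \<in> K"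
    from M[OF this, of i] have "\<bar>g p u (X i p)\<bar> \<le> \<bar>M i\<bar>"
      by (simp add: to_origin_def metric_frame_sum)
    also have "\<dots> \<le> (\<Sum>i\<in>UNIV. \<bar>M i\<bar>)" by (rule member_le_sum) auto
    finally show "\<bar>g p u (X i p)\<bar> \<le> (\<Sum>i\<in>UNIV. \<bar>M i\<bar>)" .
  qed
qed

section \<open>Divergence\<close>

text \<open>A vector in the kernel of the Gram matrix would be isotropic.\<close>

lemma volume_determinant_nonzero: "det (\<chi> i j. g p (axis i 1) (axis j 1)) \<noteq> 0"
proof -
  let ?A = "(\<chi> i j. g p (axis i 1) (axis j 1)) "
  have "v = 0" if "?A *v v = 0" for v
  proof (rule ccontr)
    assume "v \<noteq> 0"
    have v: "v = (\<Sum>i\<in>UNIV. v $ i *\<^sub>R axis i 1)"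
      using basis_expansion[of v] by (simp add: scalar_mult_eq_scaleR)
    have "g p (axis i 1) v = (?A *v v) $ i" for i
      by (subst v) (simp add: linear_sum[OF linear_metric(2)] linear_scale[OF linear_metric(2)]
        matrix_vector_mult_def mult.commute)
    moreover have "g p v v = (\<Sum>i\<in>UNIV. v $ i * g p (axis i 1) v)"
      by (subst (1) v) (simp add: linear_sum[OF linear_metric(1)] linear_scale[OF linear_metric(1)])
    ultimately have "g p v v = 0" using that by simp
    with metric_positive[OF \<open>v \<noteq> 0\<close>, of p] show False by simp
  qed
  then have "\<exists>B. B ** ?A = mat 1" unfolding matrix_left_invertible_ker by blast
  then show ?thesis by (simp add: invertible_det_nz[symmetric] invertible_left_inverse)
qed

lemma volume_density_nonzero: "volume_density g p \<noteq> 0"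
  using volume_determinant_nonzero by (simp add: volume_density_def)

lemma C1_volume_density: "C1 (volume_density g)"
proof -
  have entry: "C1 (\<lambda>p. g p u v)" for u v
    using metric(1) unfolding riemannian_metric_def smooth_def C1_def by blast
  have D: "C1 (\<lambda>p. det (\<chi> i j. g p (axis i 1) (axis j 1)))"
    unfolding det_def vec_lambda_beta
    by (intro C1_sum C1_mult C1_prod C1_const entry finite_permutations finite)
  show ?thesis
    unfolding volume_density_def[abs_def]
  proof (rule C1_real_compose[OF _ _ D])
    have "(sqrt has_real_derivative inverse (sqrt \<bar>x\<bar>) / 2) (at x)"
      if "x = det (\<chi> i j. g p (axis i 1) (axis j 1))" for p x
      using volume_determinant_nonzero[of p] that
      by (intro DERIV_real_sqrt_generic) (auto simp: abs_if real_sqrt_minus)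
    then show "(sqrt has_real_derivative inverse (sqrt \<bar>det (\<chi> i j. g p (axis i 1) (axis j 1))\<bar>) / 2)
        (at (det (\<chi> i j. g p (axis i 1) (axis j 1))))" for p
      by blast
    show "continuous_on (range (\<lambda>p. det (\<chi> i j. g p (axis i 1) (axis j 1)))) (\<lambda>x. inverse (sqrt \<bar>x\<bar>) / 2)"
      by (intro continuous_intros) (auto simp: volume_determinant_nonzero)
  qed
qed

lemma C1_density_component:
  assumes "C1 U" shows "C1 (\<lambda>q. volume_density g q * U q $ i)"
  by (intro C1_mult C1_volume_density C1_bounded_linear[OF bounded_linear_vec_nth] assms)

lemma frechet_derivative_add_C1:
  assumes "C1 f" "C1 h"
  shows "frechet_derivative (\<lambda>x. f x + h x) (at x) v = frechet_derivative f (at x) v + frechet_derivative h (at x) v"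
  using frechet_derivative_at[OF has_derivative_add[OF assms[THEN C1_has_derivative]], of x] by (metis)

lemma frechet_derivative_mult_C1:
  fixes f h :: "'a::real_normed_vector \<Rightarrow> real"
  assumes "C1 f" "C1 h"
  shows "frechet_derivative (\<lambda>x. f x * h x) (at x) v
    = f x * frechet_derivative h (at x) v + frechet_derivative f (at x) v * h x"
  using frechet_derivative_at[OF has_derivative_mult[OF assms[THEN C1_has_derivative]], of x] by (metis)

lemma divergence_add:
  assumes "C1 U" "C1 W"
  shows "divergence g (\<lambda>p. U p + W p) p = divergence g U p + divergence g W p"
  unfolding divergence_def
  using frechet_derivative_add_C1[OF C1_density_component[OF assms(1)] C1_density_component[OF assms(2)]]
  by (simp add: distrib_left sum.distrib add_divide_distrib)

lemma divergence_scale: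
  assumes "C1 U" "C1 \<theta>"
  shows "divergence g (\<lambda>p. \<theta> p *\<^sub>R U p) p = \<theta> p * divergence g U p + frechet_derivative \<theta> (at p) (U p)"
proof -
  let ?r = "volume_density g" and ?D = "frechet_derivative \<theta> (at p)"
  have lin: "linear ?D" using C1_has_derivative[OF assms(2)] has_derivative_linear by blast
  have "frechet_derivative (\<lambda>q. ?r q * (\<theta> q *\<^sub>R U q) $ i) (at p) (axis i 1)
    = \<theta> p * frechet_derivative (\<lambda>q. ?r q * U q $ i) (at p) (axis i 1) + ?r p * (U p $ i * ?D (axis i 1))" for i
    using frechet_derivative_mult_C1[OF assms(2) C1_density_component[OF assms(1)], of i p "axis i 1"]
    by (simp add: mult_ac)
  then have "divergence g (\<lambda>p. \<theta> p *\<^sub>R U p) p = \<theta> p * divergence g U p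
      + (?r p * (\<Sum>i\<in>UNIV. U p $ i * ?D (axis i 1))) / ?r p"
    unfolding divergence_def by (simp add: sum.distrib sum_distrib_left add_divide_distrib)
  moreover have "?D (U p) = (\<Sum>i\<in>UNIV. U p $ i * ?D (axis i 1))"
  proof -
    have "U p = (\<Sum>i\<in>UNIV. U p $ i *\<^sub>R axis i 1)"
      using basis_expansion[of "U p"] by (simp add: scalar_mult_eq_scaleR)
    then have "?D (U p) = ?D (\<Sum>i\<in>UNIV. U p $ i *\<^sub>R axis i 1)" by simp
    then show ?thesis by (simp add: linear_sum[OF lin] linear_scale[OF lin])
  qed
  ultimately show ?thesis using volume_density_nonzero[of p] by simp
qed

lemma divergence_blend:
  assumes U: "C1 U" "C1 W" and \<theta>: "C1 \<theta>"
  shows "divergence g (\<lambda>p. (1 - \<theta> p) *\<^sub>R U p + \<theta> p *\<^sub>R W p) p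
    = (1 - \<theta> p) * divergence g U p + \<theta> p * divergence g W p
      + frechet_derivative \<theta> (at p) (W p - U p)"
proof -
  have lin: "linear (frechet_derivative \<theta> (at p))"
    using C1_has_derivative[OF \<theta>] has_derivative_linear by blast
  have "((\<lambda>p. 1 - \<theta> p) has_derivative (\<lambda>v. 0 - frechet_derivative \<theta> (at p) v)) (at p)"
    by (intro has_derivative_diff has_derivative_const C1_has_derivative \<theta>)
  from frechet_derivative_at[OF this]
  have "frechet_derivative (\<lambda>p. 1 - \<theta> p) (at p) v = - frechet_derivative \<theta> (at p) v" for v
    by (simp add: fun_eq_iff)
  then show ?thesis
    by (subst divergence_add)
      (auto intro!: C1_scaleR C1_diff C1_const U \<theta> simp: divergence_scale U \<theta> C1_diff C1_const linear_diff[OF lin])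
qed

lemma continuous_divergence:
  assumes "C1 U" shows "continuous_on UNIV (divergence g U)"
  unfolding divergence_def[abs_def]
  by (intro continuous_intros C1_continuous_derivative C1_density_component
      C1_continuous C1_volume_density assms) (use volume_density_nonzero in blast)

lemma divergence_outside_support:
  assumes "p \<notin> closure {p. U p \<noteq> 0}"
  shows "divergence g U p = 0"
proof -
  have "frechet_derivative (\<lambda>q. volume_density g q * U q $ i) (at p) = (\<lambda>v. 0)" for i
  proof (rule frechet_derivative_at[symmetric], rule has_derivative_transform_within_open)
    show "((\<lambda>q. 0) has_derivative (\<lambda>v. 0)) (at p)" by simp
    show "open (- closure {p. U p \<noteq> 0})" by auto
    show "p \<in> - closure {p. U p \<noteq> 0}" using assms by simp
    show "0 = volume_density g q * U q $ i" if "q \<in> - closure {p. U p \<noteq> 0}" for q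
    proof -
      have "U q = 0" using that closure_subset[of "{p. U p \<noteq> 0}"] by auto
      then show ?thesis by simp
    qed
  qed
  then show ?thesis by (simp add: divergence_def)
qed

text \<open>The divergence is continuous with compact support.\<close>

lemma integrable_divergence:
  assumes "U \<in> admissible_fields X K"
  shows "integrable lebesgue (divergence g U)"
proof -
  let ?S = "closure {p. U p \<noteq> 0}"
  have U: "C1 U" "compact ?S" using assms by (auto simp: admissible_iff)
  have "integrable lborel (\<lambda>p. indicator ?S p *\<^sub>R divergence g U p)"
    by (rule borel_integrable_compact[OF U(2)])
      (rule continuous_on_subset[OF continuous_divergence[OF U(1)] subset_UNIV])
  moreover have "(\<lambda>p. indicator ?S p *\<^sub>R divergence g U p) = divergence g U"
    using divergence_outside_support[of _ U] by (auto simp: indicator_def fun_eq_iff)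
  moreover have "divergence g U \<in> borel_measurable lborel"
    using borel_measurable_continuous_onI[OF continuous_divergence[OF U(1)]] by simp
  ultimately show ?thesis by (simp add: integrable_completion)
qed

lemma set_integrable_divergence:
  assumes "U \<in> admissible_fields X K" "E \<in> sets lebesgue"
  shows "set_integrable lebesgue E (divergence g U)"
  unfolding set_integrable_def
  by (rule integrable_mult_indicator[OF assms(2) integrable_divergence[OF assms(1)]])

section \<open>Perimeter\<close>

abbreviation "P \<equiv> perimeter X K g"

lemma integral_divergence_le_perimeter:
  "U \<in> admissible_fields X K \<Longrightarrow> ereal (LINT p:E|lebesgue. divergence g U p) \<le> P E"
  unfolding perimeter_def by (rule SUP_upper)

lemma perimeter_leI:
  "(\<And>U. U \<in> admissible_fields X K \<Longrightarrow> ereal (LINT p:E|lebesgue. divergence g U p) \<le> B) \<Longrightarrow> P E \<le> B"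
  unfolding perimeter_def by (rule SUP_least)

lemma perimeter_nonneg: "0 \<le> P E"
proof -
  have "divergence g (\<lambda>p. 0) p = 0" for p
    by (simp add: divergence_def)
  then show ?thesis
    using integral_divergence_le_perimeter[OF zero_admissible, of E] by (simp add: zero_ereal_def)
qed

lemma perimeter_disjoint_Union_le:
  assumes S: "\<And>k::nat. S k \<in> sets lebesgue" "disjoint_family S"
    and B: "\<And>N. (\<Sum>k<N. P (S k)) \<le> B"
  shows "P (\<Union>k. S k) \<le> B"
proof (rule perimeter_leI)
  fix U assume U: "U \<in> admissible_fields X K"
  let ?I = "\<lambda>E. LINT p:E|lebesgue. divergence g U p"
  have int: "set_integrable lebesgue (\<Union>k. S k) (divergence g U)"
    by (rule set_integrable_divergence[OF U]) (use S in auto)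
  have "(\<lambda>N. ?I (\<Union>k<N. S k)) \<longlonglongrightarrow> ?I (\<Union>N. \<Union>k<N. S k)"
  proof (rule set_integral_cont_up)
    show "(\<Union>k<N. S k) \<in> sets lebesgue" for N using S by auto
    show "incseq (\<lambda>N. \<Union>k<N. S k)" by (intro monoI UN_mono) auto
    show "set_integrable lebesgue (\<Union>N. \<Union>k<N. S k) (divergence g U)"
      by (rule set_integrable_divergence[OF U]) (use S in auto)
  qed
  also have "(\<Union>N. \<Union>k<N. S k) = (\<Union>k. S k)" by auto
  finally have lim: "(\<lambda>N. ereal (?I (\<Union>k<N. S k))) \<longlonglongrightarrow> ereal (?I (\<Union>k. S k))"
    by simp
  have "ereal (?I (\<Union>k<N. S k)) \<le> B" for N
  proof -
    have "?I (\<Union>k<N. S k) = (\<Sum>k<N. ?I (S k))"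
    proof (rule set_integral_finite_Union)
      show "disjoint_family_on S {..<N}" using S(2) by (rule disjoint_family_on_mono[rotated]) auto
      show "set_integrable lebesgue (S k) (divergence g U)" for k
        by (rule set_integrable_divergence[OF U S(1)])
    qed (use S in auto)
    then have "ereal (?I (\<Union>k<N. S k)) = (\<Sum>k<N. ereal (?I (S k)))" by simp
    also have "\<dots> \<le> (\<Sum>k<N. P (S k))"
      by (intro sum_mono integral_divergence_le_perimeter U)
    finally show ?thesis using B[of N] by (rule order_trans)
  qed
  then show "ereal (?I (\<Union>k. S k)) \<le> B"
    by (intro LIMSEQ_le_const2[OF lim]) auto
qed

lemma perimeter_disjoint_Un_le:
  assumes "A \<in> sets lebesgue" "B \<in> sets lebesgue" "A \<inter> B = {}"
  shows "P (A \<union> B) \<le> P A + P B"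
proof (rule perimeter_leI)
  fix U assume U: "U \<in> admissible_fields X K"
  have "(LINT p:A \<union> B|lebesgue. divergence g U p)
    = (LINT p:A|lebesgue. divergence g U p) + (LINT p:B|lebesgue. divergence g U p)"
    by (rule set_integral_Un[OF assms(3)]) (intro set_integrable_divergence U assms)+
  then show "ereal (LINT p:A \<union> B|lebesgue. divergence g U p) \<le> P A + P B"
    using add_mono[OF integral_divergence_le_perimeter[OF U, of A] integral_divergence_le_perimeter[OF U, of B]]
    by simp
qed

text \<open>A direction in which the group translation is the Euclidean one preserves the whole
  structure: the derivative of that translation is the identity, so the frame and the metric are
  constant along it.\<close>

lemma perimeter_translate_le:
  assumes z: "\<And>y. gmult z y = z + y" and E: "E \<in> sets lebesgue"
  shows "P ((+) z ` E) \<le> P E"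
proof (rule perimeter_leI)
  fix U assume U: "U \<in> admissible_fields X K"
  define W where "W p = U (z + p)" for p
  have gz: "gmult z = (\<lambda>y. z + y)" using z by (rule ext)
  have "((\<lambda>y. z + y) has_derivative (\<lambda>v. v)) (at y)" for y
    by (auto intro!: derivative_eq_intros)
  from frechet_derivative_at[OF this]
  have D: "frechet_derivative (gmult z) (at y) = (\<lambda>v. v)" for y
    unfolding gz by simp
  have X: "X i (z + p) = X i p" for i p
    using X_left_invariant[of i] unfolding left_invariant_def by (metis D z)
  have g: "g (z + p) u v = g p u v" for p u v
    using metric(2) unfolding left_invariant_metric_def by (metis D z)
  have rho: "volume_density g (z + p) = volume_density g p" for p
    by (simp add: volume_density_def g)
  have W: "W \<in> admissible_fields X K"
    unfolding admissible_iff
  proof (intro conjI allI)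
    show "C1 W" unfolding W_def[abs_def] by (rule C1_translate[OF admissible_C1[OF U]])
    have "{p. U p \<noteq> 0} = (+) z ` {p. W p \<noteq> 0}"
      by (auto simp: W_def image_iff intro!: exI[of _ "_ - z"])
    then have "closure {p. W p \<noteq> 0} = (+) (- z) ` closure {p. U p \<noteq> 0}"
      by (simp add: closure_translation image_image)
    moreover have "compact (closure {p. U p \<noteq> 0})" using U by (simp only: admissible_iff)
    ultimately show "compact (closure {p. W p \<noteq> 0})"
      by (simp only: compact_translation)
    fix p
    have "U (z + p) \<in> horizontal X (z + p)" "to_origin (z + p) (U (z + p)) \<in> K"
      using U by (auto simp: admissible_iff)
    then show "W p \<in> horizontal X p" "to_origin p (W p) \<in> K"
      by (simp_all add: W_def horizontal_def to_origin_def X g)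
  qed
  have div: "divergence g W p = divergence g U (z + p)" for p
  proof -
    have "frechet_derivative (\<lambda>q. volume_density g q * W q $ i) (at p)
      = frechet_derivative (\<lambda>q. volume_density g q * U q $ i) (at (z + p))" for i
      using frechet_derivative_translate[of "\<lambda>q. volume_density g q * U q $ i" z p]
        C1_density_component[OF admissible_C1[OF U], of i]
      by (simp add: C1_iff W_def rho)
    then show ?thesis by (simp add: divergence_def rho)
  qed
  have "(LINT p:(+) z ` E|lebesgue. divergence g U p) = (LINT p:E|lebesgue. divergence g U (z + p))"
    by (rule set_integral_lebesgue_translate[OF integrable_divergence[OF U] E])
  also have "\<dots> = (LINT p:E|lebesgue. divergence g W p)" by (simp add: div)
  finally show "ereal (LINT p:(+) z ` E|lebesgue. divergence g U p) \<le> P E"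
    using integral_divergence_le_perimeter[OF W, of E] by simp
qed

end

section \<open>Slow growth of monotone functions and a step function\<close>

text \<open>If \<open>m\<close> grew to the left of every point \<open>R \<ge> \<alpha>\<close> with rate above \<open>c\<close>, then the growth from
  \<open>\<alpha>\<close> to \<open>\<alpha> + B / c + 1\<close> would exceed \<open>B\<close>: the points from which the right end is reached with rate
  at least \<open>c\<close> have an infimum, which belongs to them by monotonicity and cannot lie above \<open>\<alpha>\<close>.\<close>

lemma mono_slow_growth_point:
  fixes m :: "real \<Rightarrow> real"
  assumes mono: "mono m" and bd: "\<And>r. 0 \<le> m r" "\<And>r. m r \<le> B" and "c > 0"
  shows "\<exists>R\<ge>\<alpha>. \<forall>\<delta>>0. \<exists>r. R - \<delta> < r \<and> r < R \<and> m R - m r \<le> c * (R - r)"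
proof (rule ccontr)
  assume neg: "\<not> ?thesis"
  have no: "\<exists>\<delta>>0. \<forall>r. R - \<delta> < r \<and> r < R \<longrightarrow> m R - m r > c * (R - r)" if "R \<ge> \<alpha>" for R
    using that neg by (meson not_le)
  have "B \<ge> 0" using bd[of 0] by linarith
  define b where "b = \<alpha> + B / c + 1"
  have b: "b > \<alpha>" using \<open>B \<ge> 0\<close> \<open>c > 0\<close> by (simp add: b_def add_nonneg_pos)
  define S where "S = {r. \<alpha> \<le> r \<and> r \<le> b \<and> m b - m r \<ge> c * (b - r)}"
  have bS: "b \<in> S" using b by (simp add: S_def)
  have bdd: "bdd_below S" by (rule bdd_belowI[of _ \<alpha>]) (simp add: S_def)
  define s where "s = Inf S"
  have s: "\<alpha> \<le> s" "s \<le> b"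
    unfolding s_def using bS bdd by (auto intro!: cInf_greatest cInf_lower simp: S_def)
  have sS: "s \<in> S"
  proof -
    have "c * (b - s) \<le> (m b - m s) + e" if "e > 0" for e
    proof -
      have "Inf S < s + e / c" using \<open>c > 0\<close> that by (simp add: s_def)
      then obtain r where r: "r \<in> S" "r < s + e / c" using cInf_lessD[of S] bS by blast
      have "s \<le> r" unfolding s_def by (rule cInf_lower[OF r(1) bdd])
      then have "m s \<le> m r" by (rule monoD[OF mono])
      moreover have "m b - m r \<ge> c * (b - r)" using r(1) by (simp add: S_def)
      moreover have "c * r \<le> c * s + e" using r(2) \<open>c > 0\<close> by (simp add: field_simps)
      ultimately show ?thesis by (simp add: algebra_simps)
    qed
    then have "c * (b - s) \<le> m b - m s" by (rule field_le_epsilon)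
    with s show ?thesis by (simp add: S_def)
  qed
  have "s = \<alpha>"
  proof (rule ccontr)
    assume "s \<noteq> \<alpha>"
    with s have "s > \<alpha>" by simp
    from no[OF s(1)] obtain \<delta> where \<delta>: "\<delta> > 0" "\<And>r. s - \<delta> < r \<Longrightarrow> r < s \<Longrightarrow> m s - m r > c * (s - r)"
      by blast
    define r where "r = max \<alpha> (s - \<delta> / 2)"
    have r: "s - \<delta> < r" "r < s" "\<alpha> \<le> r" using \<delta>(1) \<open>s > \<alpha>\<close> by (auto simp: r_def max_def)
    have "c * (b - r) = c * (b - s) + c * (s - r)" by (simp add: algebra_simps)
    moreover have "c * (b - s) \<le> m b - m s" using sS by (simp add: S_def)
    ultimately have "c * (b - r) \<le> m b - m r" using \<delta>(2)[OF r(1,2)] by linarith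
    then have "r \<in> S" using r s by (simp add: S_def)
    then have "s \<le> r" unfolding s_def using bdd by (rule cInf_lower)
    with r(2) show False by simp
  qed
  with sS have "c * (b - \<alpha>) \<le> m b - m \<alpha>" by (simp add: S_def)
  moreover have "c * (b - \<alpha>) = B + c" using \<open>c > 0\<close> by (simp add: b_def field_simps)
  ultimately show False using bd(1)[of \<alpha>] bd(2)[of b] \<open>c > 0\<close> by linarith
qed

lemma DERIV_positive_part_square: "((\<lambda>t. (max 0 t)\<^sup>2) has_real_derivative 2 * max 0 t) (at (t::real))"
proof (cases t "0::real" rule: linorder_cases)
  case less
  have "((\<lambda>t. 0) has_real_derivative 2 * max 0 t) (at t)" using less by simp
  then show ?thesis
    by (rule has_field_derivative_transform_within_open[where S = "{..<0}"]) (use less in auto)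
next
  case greater
  have "((\<lambda>t. t\<^sup>2) has_real_derivative 2 * max 0 t) (at t)"
    using greater by (auto intro!: derivative_eq_intros)
  then show ?thesis
    by (rule has_field_derivative_transform_within_open[where S = "{0<..}"]) (use greater in auto)
next
  case equal
  have "(\<lambda>h::real. max 0 h) \<midarrow>0\<rightarrow> max 0 0" by (intro tendsto_intros)
  moreover have "\<forall>\<^sub>F h::real in at 0. max 0 h = ((max 0 (0 + h))\<^sup>2 - (max 0 0)\<^sup>2) / h"
    by (rule eventually_mono[OF eventually_neq_at_within[of 0]])
      (auto simp: max_def power2_eq_square)
  ultimately show ?thesis
    unfolding equal DERIV_def by (simp add: Lim_transform_eventually)
qed

text \<open>A continuously differentiable step from \<open>0\<close> to \<open>1\<close> with slope at most \<open>2\<close>, a quadratic spline.\<close>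

definition step :: "real \<Rightarrow> real" where
  "step t = 2 * (max 0 t)\<^sup>2 - 4 * (max 0 (t - 1/2))\<^sup>2 + 2 * (max 0 (t - 1))\<^sup>2"

definition step_slope :: "real \<Rightarrow> real" where
  "step_slope t = 4 * max 0 t - 8 * max 0 (t - 1/2) + 4 * max 0 (t - 1)"

lemma DERIV_step: "(step has_real_derivative step_slope t) (at t)"
proof -
  have shift: "((\<lambda>t. (max 0 (t - a))\<^sup>2) has_real_derivative 2 * max 0 (t - a)) (at t)" for a
  proof -
    have "((\<lambda>t. t - a) has_real_derivative 1) (at t)" by (auto intro!: derivative_eq_intros)
    from DERIV_chain2[OF DERIV_positive_part_square this] show ?thesis by simp
  qed
  show ?thesis
    unfolding step_def[abs_def] step_slope_def
    by (rule derivative_eq_intros DERIV_positive_part_square shift refl)+ simp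
qed

lemma continuous_step_slope: "continuous_on A step_slope"
  unfolding step_slope_def[abs_def] by (intro continuous_intros)

lemma step_slope_bounds: "0 \<le> step_slope t" "step_slope t \<le> 2"
  unfolding step_slope_def max_def by auto

lemma step_slope_eq_0: "t \<le> 0 \<or> 1 \<le> t \<Longrightarrow> step_slope t = 0"
  unfolding step_slope_def max_def by auto

lemma step_eq_0: "t \<le> 0 \<Longrightarrow> step t = 0"
  unfolding step_def max_def by auto

lemma step_eq_1: "1 \<le> t \<Longrightarrow> step t = 1"
  unfolding step_def max_def by (auto simp: power2_eq_square algebra_simps)

lemma step_mono: "s \<le> t \<Longrightarrow> step s \<le> step t"
  using DERIV_nonneg_imp_nondecreasing[of s t step] DERIV_step step_slope_bounds(1) by blast

lemma step_bounds: "0 \<le> step t" "step t \<le> 1"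
  using step_mono[of "min t 0" t] step_mono[of t "max t 1"] step_eq_0[of "min t 0"] step_eq_1[of "max t 1"]
  by auto

context sub_finsler_nilpotent_group
begin

section \<open>Cutting a set\<close>

text \<open>Levels \<open>r n\<close> below \<open>R\<close> tend to \<open>R\<close> such that the part of \<open>E\<close> between \<open>r n\<close> and \<open>R\<close> has measure
  at most \<open>c * (R - r n)\<close>. The blend of \<open>U1\<close> and \<open>U2\<close> by the step from \<open>r n\<close> to \<open>R\<close> is admissible,
  and its divergence is the blend of the divergences plus a term supported in that part and bounded
  by \<open>4 * C / (R - r n)\<close>; so this term contributes at most \<open>4 * C * c\<close>. As \<open>n\<close> grows the steps
  converge to the sharp cut.\<close>

lemma perimeter_cut_test_fields:
  fixes \<phi> :: "'d point \<Rightarrow> real"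
  assumes \<phi>: "C1 \<phi>" and E: "E \<in> sets lebesgue" "emeasure lebesgue E < \<infinity>"
    and C: "C \<ge> 0" "\<And>U x. U \<in> admissible_fields X K \<Longrightarrow> x \<in> E \<Longrightarrow> \<bar>frechet_derivative \<phi> (at x) (U x)\<bar> \<le> C"
    and q: "P E = ereal q"
    and c: "4 * C * c \<le> \<epsilon>"
    and R: "\<And>\<delta>. \<delta> > 0 \<Longrightarrow> \<exists>r. R - \<delta> < r \<and> r < R \<and>
      measure lebesgue (E \<inter> {x. \<phi> x < R}) - measure lebesgue (E \<inter> {x. \<phi> x < r}) \<le> c * (R - r)"
    and U: "U1 \<in> admissible_fields X K" "U2 \<in> admissible_fields X K"
  shows "(LINT p:E \<inter> {x. \<phi> x < R}|lebesgue. divergence g U1 p)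
    + (LINT p:E \<inter> {x. \<phi> x \<ge> R}|lebesgue. divergence g U2 p) \<le> q + \<epsilon>"
proof -
  let ?d1 = "divergence g U1" and ?d2 = "divergence g U2"
  have "\<exists>r. R - inverse (real (Suc n)) < r \<and> r < R \<and>
      measure lebesgue (E \<inter> {x. \<phi> x < R}) - measure lebesgue (E \<inter> {x. \<phi> x < r}) \<le> c * (R - r)" for n
    by (rule R) simp
  then obtain r where r: "\<And>n. R - inverse (real (Suc n)) < r n" "\<And>n. r n < R"
    "\<And>n. measure lebesgue (E \<inter> {x. \<phi> x < R}) - measure lebesgue (E \<inter> {x. \<phi> x < r n}) \<le> c * (R - r n)"
    by metis
  have "(\<lambda>n. R - inverse (real (Suc n))) \<longlonglongrightarrow> R - 0"
    by (intro tendsto_intros LIMSEQ_inverse_real_of_nat)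
  then have rlim: "r \<longlonglongrightarrow> R"
    by (intro tendsto_sandwich[OF _ _ _ tendsto_const, of "\<lambda>n. R - inverse (real (Suc n))" r])
      (use r in \<open>auto intro!: always_eventually less_imp_le\<close>)
  have cont_\<phi>: "continuous_on UNIV \<phi>" by (rule C1_continuous[OF \<phi>])
  then have meas_\<phi>: "\<phi> \<in> borel_measurable lebesgue"
    by (intro measurable_completion) (simp add: borel_measurable_continuous_onI)
  have sets: "E \<inter> {x. \<phi> x < s} \<in> sets lebesgue" "E \<inter> {x. s \<le> \<phi> x} \<in> sets lebesgue" for s
    using E(1) meas_\<phi> by measurable
  define \<theta> where "\<theta> n x = step ((\<phi> x - r n) / (R - r n))" for n x
  define f where "f n x = (1 - \<theta> n x) * ?d1 x + \<theta> n x * ?d2 x" for n x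
  have \<theta>D: "(\<theta> n has_derivative (\<lambda>v. step_slope ((\<phi> x - r n) / (R - r n)) * (frechet_derivative \<phi> (at x) v / (R - r n)))) (at x)" for n x
  proof -
    have "((\<lambda>x. (\<phi> x - r n) / (R - r n)) has_derivative (\<lambda>v. frechet_derivative \<phi> (at x) v / (R - r n))) (at x)"
      using C1_has_derivative[OF \<phi>, of x] r(2)[of n] by (auto intro!: derivative_eq_intros)
    from has_derivative_real_compose[OF DERIV_step this] show ?thesis
      unfolding \<theta>_def[abs_def] .
  qed
  have C1\<theta>: "C1 (\<theta> n)" for n
  proof (rule C1I[OF \<theta>D])
    show "continuous_on UNIV (\<lambda>x. step_slope ((\<phi> x - r n) / (R - r n)) * (frechet_derivative \<phi> (at x) v / (R - r n)))" for v
      by (intro continuous_intros continuous_on_compose2[OF continuous_step_slope] cont_\<phi>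
          C1_continuous_derivative[OF \<phi>]) (use r(2)[of n] in auto)
  qed
  have \<theta>01: "0 \<le> \<theta> n x" "\<theta> n x \<le> 1" for n x
    by (simp_all add: \<theta>_def step_bounds)
  have dmeas: "divergence g U \<in> borel_measurable lebesgue" if "U \<in> admissible_fields X K" for U
    using integrable_divergence[OF that] by (rule borel_measurable_integrable)
  have \<theta>meas: "\<theta> n \<in> borel_measurable lebesgue" for n
    by (intro measurable_completion) (simp add: borel_measurable_continuous_onI C1_continuous[OF C1\<theta>])
  have fmeas: "f n \<in> borel_measurable lebesgue" for n
    unfolding f_def[abs_def] by (intro borel_measurable_add borel_measurable_times borel_measurable_diff
        borel_measurable_const \<theta>meas dmeas U)
  have fbd: "\<bar>f n x\<bar> \<le> \<bar>?d1 x\<bar> + \<bar>?d2 x\<bar>" for n x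
  proof -
    have "\<bar>(1 - \<theta> n x) * ?d1 x\<bar> \<le> 1 * \<bar>?d1 x\<bar>" "\<bar>\<theta> n x * ?d2 x\<bar> \<le> 1 * \<bar>?d2 x\<bar>"
      unfolding abs_mult using \<theta>01[of n x] by (intro mult_right_mono; simp)+
    then show ?thesis unfolding f_def by linarith
  qed
  have dom: "integrable lebesgue (\<lambda>x. \<bar>?d1 x\<bar> + \<bar>?d2 x\<bar>)"
    by (intro Bochner_Integration.integrable_add integrable_abs integrable_divergence U)
  have fint: "integrable lebesgue (f n)" for n
    by (rule Bochner_Integration.integrable_bound[OF dom fmeas]) (use fbd in auto)
  have Ef: "integrable lebesgue (\<lambda>x. indicator E x *\<^sub>R f n x)" for n
    by (rule integrable_mult_indicator[OF E(1) fint])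
  have main: "(\<integral>x. indicator E x *\<^sub>R f n x \<partial>lebesgue) \<le> q + \<epsilon>" for n
  proof -
    define W where "W p = (1 - \<theta> n p) *\<^sub>R U1 p + \<theta> n p *\<^sub>R U2 p" for p
    define strip where "strip = E \<inter> {x. \<phi> x < R} - E \<inter> {x. \<phi> x < r n}"
    define D where "D x = frechet_derivative (\<theta> n) (at x) (U2 x - U1 x)" for x
    have W: "W \<in> admissible_fields X K"
      unfolding W_def[abs_def] by (intro admissible_blend U C1\<theta> \<theta>01)
    have divW: "divergence g W x = f n x + D x" for x
      unfolding W_def[abs_def] f_def D_def by (intro divergence_blend admissible_C1 U C1\<theta>)
    have strip: "strip \<in> fmeasurable lebesgue"
    proof (rule fmeasurableI2[of E])
      show "E \<in> fmeasurable lebesgue" using E by (intro fmeasurableI) auto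
      show "strip \<in> sets lebesgue" unfolding strip_def by (intro sets.Diff sets)
    qed (auto simp: strip_def)
    have measure_strip: "measure lebesgue strip \<le> c * (R - r n)"
    proof -
      have fm: "E \<inter> {x. \<phi> x < s} \<in> fmeasurable lebesgue" for s
        by (rule fmeasurableI2[of E]) (use E sets in \<open>auto intro!: fmeasurableI\<close>)
      have "E \<inter> {x. \<phi> x < r n} \<subseteq> E \<inter> {x. \<phi> x < R}"
        using r(2)[of n] by auto
      then have "measure lebesgue strip
        = measure lebesgue (E \<inter> {x. \<phi> x < R}) - measure lebesgue (E \<inter> {x. \<phi> x < r n})"
        unfolding strip_def using fm by (intro measurable_measure_Diff) auto
      with r(3)[of n] show ?thesis by linarith
    qed
    have Dbd: "- (indicator E x * D x) \<le> 4 * C / (R - r n) * indicator strip x" for x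
    proof (cases "x \<in> E \<and> r n < \<phi> x \<and> \<phi> x < R")
      case True
      let ?s = "step_slope ((\<phi> x - r n) / (R - r n))" and ?F = "frechet_derivative \<phi> (at x)"
      have lin: "linear ?F" using C1_has_derivative[OF \<phi>] has_derivative_linear by blast
      have "D x = ?s * (?F (U2 x - U1 x) / (R - r n))"
        unfolding D_def using frechet_derivative_at[OF \<theta>D[of n x]] by (simp add: fun_eq_iff)
      also have "?F (U2 x - U1 x) = ?F (U2 x) - ?F (U1 x)" by (rule linear_diff[OF lin])
      finally have "\<bar>D x\<bar> = ?s * (\<bar>?F (U2 x) - ?F (U1 x)\<bar> / (R - r n))"
        using step_slope_bounds(1) r(2)[of n] by (simp add: abs_mult)
      also have "\<dots> \<le> 2 * ((2 * C) / (R - r n))"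
      proof (intro mult_mono divide_right_mono step_slope_bounds)
        show "\<bar>?F (U2 x) - ?F (U1 x)\<bar> \<le> 2 * C"
          using C(2)[OF U(1), of x] C(2)[OF U(2), of x] True by linarith
      qed (use r(2)[of n] in auto)
      finally have "\<bar>D x\<bar> \<le> 4 * C / (R - r n)" by simp
      moreover have "x \<in> strip" using True by (auto simp: strip_def)
      ultimately show ?thesis using True by simp
    next
      case False
      have "D x = 0" if "x \<in> E"
      proof -
        have "(\<phi> x - r n) / (R - r n) \<le> 0 \<or> 1 \<le> (\<phi> x - r n) / (R - r n)"
          using False that r(2)[of n] by (auto simp: divide_simps)
        then show ?thesis
          unfolding D_def using frechet_derivative_at[OF \<theta>D[of n x]] by (simp add: fun_eq_iff step_slope_eq_0)
      qed
      moreover have "0 \<le> 4 * C / (R - r n) * indicator strip x"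
        using C(1) r(2)[of n] by simp
      ultimately show ?thesis by (cases "x \<in> E") auto
    qed
    have EW: "integrable lebesgue (\<lambda>x. indicator E x *\<^sub>R divergence g W x)"
      by (rule integrable_mult_indicator[OF E(1) integrable_divergence[OF W]])
    have ED: "indicator E x * D x = indicator E x *\<^sub>R divergence g W x - indicator E x *\<^sub>R f n x" for x
      by (simp add: divW algebra_simps)
    have EDint: "integrable lebesgue (\<lambda>x. indicator E x * D x)"
      unfolding ED by (intro Bochner_Integration.integrable_diff EW Ef)
    have "(\<integral>x. indicator E x *\<^sub>R f n x \<partial>lebesgue)
      = (\<integral>x. indicator E x *\<^sub>R divergence g W x - indicator E x * D x \<partial>lebesgue)"
      by (intro Bochner_Integration.integral_cong) (auto simp: ED)
    also have "\<dots> = (LINT x:E|lebesgue. divergence g W x) + (\<integral>x. - (indicator E x * D x) \<partial>lebesgue)"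
      unfolding set_lebesgue_integral_def
      using Bochner_Integration.integral_diff[OF EW EDint] by simp
    also have "\<dots> \<le> q + 4 * C / (R - r n) * measure lebesgue strip"
    proof (rule add_mono)
      show "(LINT x:E|lebesgue. divergence g W x) \<le> q"
        using integral_divergence_le_perimeter[OF W, of E] q by simp
      have "(\<integral>x. - (indicator E x * D x) \<partial>lebesgue)
        \<le> (\<integral>x. 4 * C / (R - r n) * indicator strip x \<partial>lebesgue)"
        by (rule integral_mono)
          (use EDint strip Dbd in \<open>auto intro!: Bochner_Integration.integrable_minus integrable_mult_right
             integrable_real_indicator simp: fmeasurable_def\<close>)
      also have "\<dots> = 4 * C / (R - r n) * measure lebesgue strip"
        using strip by (simp add: fmeasurableD)
      finally show "(\<integral>x. - (indicator E x * D x) \<partial>lebesgue) \<le> 4 * C / (R - r n) * measure lebesgue strip" .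
    qed
    also have "\<dots> \<le> q + 4 * C / (R - r n) * (c * (R - r n))"
      using measure_strip C(1) r(2)[of n] by (intro add_left_mono mult_left_mono) auto
    also have "\<dots> \<le> q + \<epsilon>" using c r(2)[of n] by simp
    finally show ?thesis .
  qed
  define h where "h x = (if \<phi> x < R then ?d1 x else ?d2 x)" for x
  have "(\<lambda>n. \<integral>x. indicator E x *\<^sub>R f n x \<partial>lebesgue) \<longlonglongrightarrow> (\<integral>x. indicator E x *\<^sub>R h x \<partial>lebesgue)"
  proof (rule integral_dominated_convergence[where w = "\<lambda>x. \<bar>?d1 x\<bar> + \<bar>?d2 x\<bar>"])
    show "(\<lambda>x. indicator E x *\<^sub>R h x) \<in> borel_measurable lebesgue"
      unfolding h_def using E(1) meas_\<phi> dmeas[OF U(1)] dmeas[OF U(2)] by measurable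
    show "(\<lambda>x. indicator E x *\<^sub>R f n x) \<in> borel_measurable lebesgue" for n
      using Ef by (rule borel_measurable_integrable)
    show "AE x in lebesgue. (\<lambda>n. indicator E x *\<^sub>R f n x) \<longlonglongrightarrow> indicator E x *\<^sub>R h x"
    proof (rule AE_I2)
      fix x
      have "\<forall>\<^sub>F n in sequentially. f n x = h x"
      proof (cases "\<phi> x < R")
        case True
        from order_tendstoD(1)[OF rlim True] show ?thesis
        proof eventually_elim
          case (elim n)
          then have "\<theta> n x = 0" unfolding \<theta>_def using r(2)[of n] by (intro step_eq_0) (simp add: divide_simps)
          then show ?case using True by (simp add: f_def h_def)
        qed
      next
        case False
        then have "\<theta> n x = 1" for n
          unfolding \<theta>_def using r(2)[of n] by (intro step_eq_1) (simp add: divide_simps)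
        then show ?thesis using False by (simp add: f_def h_def)
      qed
      then have "(\<lambda>n. f n x) \<longlonglongrightarrow> h x" by (rule tendsto_eventually)
      then show "(\<lambda>n. indicator E x *\<^sub>R f n x) \<longlonglongrightarrow> indicator E x *\<^sub>R h x"
        by (intro tendsto_intros)
    qed
    show "AE x in lebesgue. norm (indicator E x *\<^sub>R f n x) \<le> \<bar>?d1 x\<bar> + \<bar>?d2 x\<bar>" for n
      using fbd by (intro AE_I2) (auto simp: indicator_def)
  qed (rule dom)
  then have "(\<integral>x. indicator E x *\<^sub>R h x \<partial>lebesgue) \<le> q + \<epsilon>"
    by (rule LIMSEQ_le_const2) (use main in auto)
  also have "(\<integral>x. indicator E x *\<^sub>R h x \<partial>lebesgue)
    = (\<integral>x. indicator (E \<inter> {x. \<phi> x < R}) x *\<^sub>R ?d1 x + indicator (E \<inter> {x. \<phi> x \<ge> R}) x *\<^sub>R ?d2 x \<partial>lebesgue)"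
    by (intro Bochner_Integration.integral_cong) (auto simp: h_def indicator_def)
  finally show ?thesis
    unfolding set_lebesgue_integral_def
    using Bochner_Integration.integral_add[OF
        set_integrable_divergence[OF U(1) sets(1), unfolded set_integrable_def]
        set_integrable_divergence[OF U(2) sets(2), unfolded set_integrable_def], of R R] by simp
qed

text \<open>Since the estimate for a pair of fields holds at a level \<open>R\<close> chosen independently of them, the
  suprema over the two fields may be taken separately.\<close>

lemma perimeter_cut:
  fixes \<phi> :: "'d point \<Rightarrow> real"
  assumes \<phi>: "C1 \<phi>" and E: "E \<in> sets lebesgue" "emeasure lebesgue E < \<infinity>"
    and C: "C \<ge> 0" "\<And>U x. U \<in> admissible_fields X K \<Longrightarrow> x \<in> E \<Longrightarrow> \<bar>frechet_derivative \<phi> (at x) (U x)\<bar> \<le> C"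
    and "\<epsilon> > 0"
  obtains R where "R \<ge> \<alpha>" "P (E \<inter> {x. \<phi> x < R}) + P (E \<inter> {x. \<phi> x \<ge> R}) \<le> P E + ereal \<epsilon>"
proof (cases "P E = \<infinity>")
  case True
  then show thesis by (intro that[of \<alpha>]) auto
next
  case False
  with perimeter_nonneg[of E] obtain q where q: "P E = ereal q" by (cases "P E") auto
  \<comment> \<open>\<open>C + 1\<close> rather than \<open>C\<close>, which may vanish.\<close>
  define c where "c = \<epsilon> / (4 * (C + 1))"
  have c: "c > 0" "4 * C * c \<le> \<epsilon>"
    using C(1) \<open>\<epsilon> > 0\<close> by (auto simp: c_def divide_simps mult_le_cancel_right)
  let ?m = "\<lambda>s. measure lebesgue (E \<inter> {x. \<phi> x < s})"
  have meas_\<phi>: "\<phi> \<in> borel_measurable lebesgue"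
    by (intro measurable_completion) (simp add: borel_measurable_continuous_onI C1_continuous[OF \<phi>])
  have fmE: "E \<in> fmeasurable lebesgue" using E by (intro fmeasurableI) auto
  have fm: "E \<inter> {x. \<phi> x < s} \<in> fmeasurable lebesgue" for s
  proof (rule fmeasurableI2[OF fmE])
    show "E \<inter> {x. \<phi> x < s} \<in> sets lebesgue" using E(1) meas_\<phi> by measurable
  qed auto
  have "mono ?m"
    by (intro monoI measure_mono_fmeasurable fm) (use fm in \<open>auto simp: fmeasurable_def\<close>)
  moreover have "?m s \<le> measure lebesgue E" for s
    using fm[of s] fmE by (intro measure_mono_fmeasurable) (auto simp: fmeasurable_def)
  ultimately obtain R where R: "R \<ge> \<alpha>"
    "\<And>\<delta>. \<delta> > 0 \<Longrightarrow> \<exists>r. R - \<delta> < r \<and> r < R \<and> ?m R - ?m r \<le> c * (R - r)"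
    using mono_slow_growth_point[of ?m "measure lebesgue E" c \<alpha>] c(1) by auto
  let ?A = "E \<inter> {x. \<phi> x < R}" and ?B = "E \<inter> {x. \<phi> x \<ge> R}"
  let ?I = "\<lambda>E U. LINT p:E|lebesgue. divergence g U p"
  have test: "?I ?A U1 + ?I ?B U2 \<le> q + \<epsilon>"
    if "U1 \<in> admissible_fields X K" "U2 \<in> admissible_fields X K" for U1 U2
    by (rule perimeter_cut_test_fields[where E = E and \<phi> = \<phi> and C = C and c = c and R = R,
          OF \<phi> E C(1) _ q c(2) R(2) that]) (rule C(2))
  have A: "P ?A \<le> ereal (q + \<epsilon> - ?I ?B U2)" if "U2 \<in> admissible_fields X K" for U2
    using test[OF _ that] by (intro perimeter_leI) (simp add: algebra_simps)
  with perimeter_nonneg[of ?A] zero_admissible obtain a where a: "P ?A = ereal a"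
    by (cases "P ?A") force+
  have "P ?B \<le> ereal (q + \<epsilon> - a)"
    using A a by (intro perimeter_leI) (simp add: algebra_simps)
  then have "P ?A + P ?B \<le> ereal a + ereal (q + \<epsilon> - a)"
    unfolding a by (intro add_left_mono)
  also have "\<dots> = P E + ereal \<epsilon>" using q by simp
  finally show thesis using R(1) by (intro that)
qed

section \<open>Decomposition into bounded pieces\<close>

lemma perimeter_empty: "P {} = 0"
  by (rule antisym[OF perimeter_leI perimeter_nonneg])
    (simp add: set_lebesgue_integral_def zero_ereal_def)

text \<open>The part above the current level is cut again, at a level higher by at least \<open>1\<close> and at half the
  previous cost; the levels tend to infinity, so every point ends up in a shell.\<close>

lemma perimeter_shells:
  fixes \<phi> :: "'d point \<Rightarrow> real"
  assumes \<phi>: "C1 \<phi>" "\<And>x. 0 \<le> \<phi> x" and E: "E \<in> sets lebesgue" "emeasure lebesgue E < \<infinity>"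
    and C: "C \<ge> 0" "\<And>U x. U \<in> admissible_fields X K \<Longrightarrow> x \<in> E \<Longrightarrow> \<bar>frechet_derivative \<phi> (at x) (U x)\<bar> \<le> C"
    and \<epsilon>: "\<epsilon> > 0"
  shows "\<exists>S :: nat \<Rightarrow> 'd point set. disjoint_family S \<and> (\<Union>k. S k) = E \<and>
    (\<forall>k. S k \<in> sets lebesgue \<and> (\<exists>B. \<forall>x\<in>S k. \<phi> x \<le> B)) \<and>
    (\<forall>N. (\<Sum>k<N. P (S k)) \<le> P E + ereal \<epsilon>)"
proof -
  let ?U = "\<lambda>a. E \<inter> {x. \<phi> x \<ge> a}" and ?S = "\<lambda>a b. E \<inter> {x. a \<le> \<phi> x \<and> \<phi> x < b}"
  have meas_\<phi>: "\<phi> \<in> borel_measurable lebesgue"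
    by (intro measurable_completion) (simp add: borel_measurable_continuous_onI C1_continuous[OF \<phi>(1)])
  have sets: "?U a \<in> sets lebesgue" "?S a b \<in> sets lebesgue" for a b
    using E(1) meas_\<phi> by measurable
  have "\<exists>a :: nat \<Rightarrow> real. \<forall>n. (n = 0 \<longrightarrow> a n = 0) \<and> (a n + 1 \<le> a (Suc n) \<and>
      P (?S (a n) (a (Suc n))) + P (?U (a (Suc n))) \<le> P (?U (a n)) + ereal (\<epsilon> / 2 ^ Suc n))"
  proof (rule dependent_nat_choice)
    fix a :: real and n :: nat
    have "emeasure lebesgue (?U a) < \<infinity>"
      using emeasure_mono[of "?U a" E lebesgue] E by (auto simp: less_top[symmetric] top_unique)
    moreover have "\<epsilon> / 2 ^ Suc n > 0" using \<epsilon> by simp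
    ultimately obtain b where b: "b \<ge> a + 1"
      "P (?U a \<inter> {x. \<phi> x < b}) + P (?U a \<inter> {x. \<phi> x \<ge> b}) \<le> P (?U a) + ereal (\<epsilon> / 2 ^ Suc n)"
      using perimeter_cut[where \<phi> = \<phi> and E = "?U a" and C = C and \<epsilon> = "\<epsilon> / 2 ^ Suc n" and \<alpha> = "a + 1", OF \<phi>(1) sets(1) _ C(1)] C(2)
      by (metis IntD1)
    moreover have "?U a \<inter> {x. \<phi> x < b} = ?S a b" "?U a \<inter> {x. \<phi> x \<ge> b} = ?U b"
      using b(1) by auto
    ultimately show "\<exists>b. (Suc n = 0 \<longrightarrow> b = 0) \<and> (a + 1 \<le> b \<and>
        P (?S a b) + P (?U b) \<le> P (?U a) + ereal (\<epsilon> / 2 ^ Suc n))"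
      by (intro exI[of _ b]) simp
  qed auto
  then obtain a :: "nat \<Rightarrow> real" where a: "\<forall>n. (n = 0 \<longrightarrow> a n = 0) \<and> (a n + 1 \<le> a (Suc n) \<and>
      P (?S (a n) (a (Suc n))) + P (?U (a (Suc n))) \<le> P (?U (a n)) + ereal (\<epsilon> / 2 ^ Suc n))" ..
  have a0: "a 0 = 0" using spec[OF a, of 0] by simp
  have a1: "a n + 1 \<le> a (Suc n)" for n using spec[OF a, of n] by (elim conjE)
  have cut: "P (?S (a n) (a (Suc n))) + P (?U (a (Suc n))) \<le> P (?U (a n)) + ereal (\<epsilon> / 2 ^ Suc n)" for n
    using spec[OF a, of n] by (elim conjE)
  define S where "S n = ?S (a n) (a (Suc n))" for n
  have mono: "a m \<le> a n" if "m \<le> n" for m n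
  proof (rule lift_Suc_mono_le[OF _ that])
    show "a n \<le> a (Suc n)" for n using a1[of n] by linarith
  qed
  have ge: "real n \<le> a n" for n
  proof (induction n)
    case (Suc n)
    then show ?case using a1[of n] by simp
  qed (simp add: a0)
  have disj: "S m \<inter> S n = {}" if "m < n" for m n
    using mono[of "Suc m" n] that by (auto simp: S_def)
  have "disjoint_family S"
    unfolding disjoint_family_on_def using disj by (metis Int_commute nat_neq_iff)
  moreover have "(\<Union>k. S k) = E"
  proof
    show "E \<subseteq> (\<Union>k. S k)"
    proof
      fix x assume "x \<in> E"
      obtain N where N: "\<phi> x < real N" using reals_Archimedean2 by blast
      have "\<exists>n. \<phi> x < a n" using ge[of N] N by (intro exI[of _ N]) linarith
      then obtain n where n: "\<phi> x < a n" "\<And>m. m < n \<Longrightarrow> \<not> \<phi> x < a m"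
        using exists_least_iff[of "\<lambda>n. \<phi> x < a n"] by blast
      with \<phi>(2)[of x] a0 obtain m where "n = Suc m" by (cases n) auto
      with n(2)[of m] have "\<not> \<phi> x < a m" by simp
      with n(1) \<open>n = Suc m\<close> \<open>x \<in> E\<close> have "x \<in> S m" by (simp add: S_def)
      then show "x \<in> (\<Union>k. S k)" by blast
    qed
  qed (auto simp: S_def)
  moreover have "S k \<in> sets lebesgue \<and> (\<exists>B. \<forall>x\<in>S k. \<phi> x \<le> B)" for k
    unfolding S_def using sets(2) by (intro conjI exI[of _ "a (Suc k)"]) auto
  moreover have "(\<Sum>k<N. P (S k)) \<le> P E + ereal \<epsilon>" for N
  proof -
    have sum: "(\<Sum>k<N. P (S k)) + P (?U (a N)) \<le> P E + ereal (\<epsilon> * (1 - 1 / 2 ^ N))"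
    proof (induction N)
      case 0
      have "?U (a 0) = E" using \<phi>(2) by (auto simp: a0)
      then show ?case by (simp add: zero_ereal_def[symmetric])
    next
      case (Suc N)
      have "(\<Sum>k<Suc N. P (S k)) + P (?U (a (Suc N)))
        = (\<Sum>k<N. P (S k)) + (P (S N) + P (?U (a (Suc N))))"
        by (simp add: add.assoc)
      also have "\<dots> \<le> (\<Sum>k<N. P (S k)) + (P (?U (a N)) + ereal (\<epsilon> / 2 ^ Suc N))"
        unfolding S_def by (intro add_left_mono cut)
      also have "\<dots> = ((\<Sum>k<N. P (S k)) + P (?U (a N))) + ereal (\<epsilon> / 2 ^ Suc N)"
        by (simp only: add.assoc)
      also have "\<dots> \<le> (P E + ereal (\<epsilon> * (1 - 1 / 2 ^ N))) + ereal (\<epsilon> / 2 ^ Suc N)"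
        by (intro add_right_mono Suc.IH)
      also have "\<dots> = P E + ereal (\<epsilon> * (1 - 1 / 2 ^ N) + \<epsilon> / 2 ^ Suc N)"
        by (simp only: add.assoc plus_ereal.simps)
      also have "\<epsilon> * (1 - 1 / 2 ^ N) + \<epsilon> / 2 ^ Suc N = \<epsilon> * (1 - 1 / 2 ^ Suc N)"
        by (simp add: field_simps)
      finally show ?case .
    qed
    have "(\<Sum>k<N. P (S k)) + 0 \<le> (\<Sum>k<N. P (S k)) + P (?U (a N))"
      by (intro add_left_mono perimeter_nonneg)
    also note sum
    also have "P E + ereal (\<epsilon> * (1 - 1 / 2 ^ N)) \<le> P E + ereal \<epsilon>"
      using \<epsilon> by (intro add_left_mono) (simp add: mult_le_cancel_left1)
    finally show ?thesis by simp
  qed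
  ultimately show ?thesis by blast
qed

definition decomposable :: "'d point set \<Rightarrow> bool" where
  "decomposable E \<longleftrightarrow> (\<forall>\<epsilon>>0. \<exists>S :: nat \<Rightarrow> 'd point set. disjoint_family S \<and> (\<Union>k. S k) = E \<and>
     (\<forall>k. S k \<in> sets lebesgue \<and> bounded (S k)) \<and> (\<forall>N. (\<Sum>k<N. P (S k)) \<le> P E + ereal \<epsilon>))"

lemma decomposable_bounded:
  assumes "E \<in> sets lebesgue" "bounded E"
  shows "decomposable E"
  unfolding decomposable_def
proof (intro allI impI)
  fix \<epsilon> :: real assume "\<epsilon> > 0"
  let ?S = "\<lambda>k::nat. if k = 0 then E else {}"
  have "(\<Sum>k<N. P (?S k)) \<le> P E + ereal \<epsilon>" for N
  proof -
    have "(\<Sum>k<N. P (?S k)) = (\<Sum>k<N. if k = 0 then P E else 0)"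
      by (intro sum.cong) (auto simp: perimeter_empty)
    also have "\<dots> \<le> P E" using perimeter_nonneg[of E] by (simp add: sum.delta)
    also have "\<dots> \<le> P E + ereal \<epsilon>" using \<open>\<epsilon> > 0\<close> by (intro ereal_le_add_self) simp
    finally show ?thesis .
  qed
  then show "\<exists>S :: nat \<Rightarrow> 'd point set. disjoint_family S \<and> (\<Union>k. S k) = E \<and>
     (\<forall>k. S k \<in> sets lebesgue \<and> bounded (S k)) \<and> (\<forall>N. (\<Sum>k<N. P (S k)) \<le> P E + ereal \<epsilon>)"
    using assms by (intro exI[of _ ?S]) (simp add: disjoint_family_on_def)
qed

lemma sum_geometric_le: "\<epsilon> \<ge> 0 \<Longrightarrow> (\<Sum>k<N. \<epsilon> / 2 ^ Suc k) \<le> (\<epsilon> :: real)"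
proof -
  assume "\<epsilon> \<ge> 0"
  have "(\<Sum>k<N. \<epsilon> / 2 ^ Suc k) = \<epsilon> * (1 - 1 / 2 ^ N)"
    by (induction N) (simp_all add: field_simps)
  then show ?thesis using \<open>\<epsilon> \<ge> 0\<close> by (simp add: mult_left_le)
qed

text \<open>Decomposing the \<open>k\<close>-th piece at cost \<open>\<epsilon> / 2 / 2 ^ Suc k\<close> keeps the total below \<open>\<epsilon>\<close>; finitely
  many of the resulting pieces lie in a finite square of indices.\<close>

lemma decomposable_nest:
  assumes "\<And>\<epsilon>. \<epsilon> > 0 \<Longrightarrow> \<exists>S :: nat \<Rightarrow> 'd point set. disjoint_family S \<and> (\<Union>k. S k) = E \<and>
     (\<forall>k. decomposable (S k)) \<and> (\<forall>N. (\<Sum>k<N. P (S k)) \<le> P E + ereal \<epsilon>)"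
  shows "decomposable E"
  unfolding decomposable_def
proof (intro allI impI)
  fix \<epsilon> :: real assume "\<epsilon> > 0"
  then obtain S :: "nat \<Rightarrow> 'd point set" where S: "disjoint_family S" "(\<Union>k. S k) = E"
    "\<And>k. decomposable (S k)" "\<And>N. (\<Sum>k<N. P (S k)) \<le> P E + ereal (\<epsilon> / 2)"
    using assms[of "\<epsilon> / 2"] by auto
  have pos: "\<epsilon> / 2 / 2 ^ Suc k > 0" for k using \<open>\<epsilon> > 0\<close> by simp
  have ex: "\<forall>k. \<exists>T :: nat \<Rightarrow> 'd point set. disjoint_family T \<and> (\<Union>l. T l) = S k \<and>
     (\<forall>l. T l \<in> sets lebesgue \<and> bounded (T l)) \<and> (\<forall>N. (\<Sum>l<N. P (T l)) \<le> P (S k) + ereal (\<epsilon> / 2 / 2 ^ Suc k))"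
    by (intro allI S(3)[unfolded decomposable_def, rule_format, OF pos])
  from choice[OF ex] obtain T :: "nat \<Rightarrow> nat \<Rightarrow> 'd point set" where
    "\<forall>k. disjoint_family (T k) \<and> (\<Union>l. T k l) = S k \<and> (\<forall>l. T k l \<in> sets lebesgue \<and> bounded (T k l)) \<and>
      (\<forall>N. (\<Sum>l<N. P (T k l)) \<le> P (S k) + ereal (\<epsilon> / 2 / 2 ^ Suc k))" ..
  then have T: "\<And>k. disjoint_family (T k)" "\<And>k. (\<Union>l. T k l) = S k"
    "\<And>k l. T k l \<in> sets lebesgue" "\<And>k l. bounded (T k l)"
    "\<And>k N. (\<Sum>l<N. P (T k l)) \<le> P (S k) + ereal (\<epsilon> / 2 / 2 ^ Suc k)"
    by blast+
  define W where "W n = T (fst (prod_decode n)) (snd (prod_decode n))" for n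
  have T_disj: "T k l \<inter> T k' l' = {}" if "(k, l) \<noteq> (k', l')" for k l k' l'
  proof (cases "k = k'")
    case True
    then show ?thesis using T(1)[of k] that unfolding disjoint_family_on_def by auto
  next
    case False
    then have "S k \<inter> S k' = {}" using S(1) unfolding disjoint_family_on_def by auto
    then show ?thesis using T(2)[of k] T(2)[of k'] by blast
  qed
  have "disjoint_family W"
    unfolding disjoint_family_on_def W_def
    by (intro ballI impI T_disj) (simp add: prod_eq_iff[symmetric] inj_eq[OF inj_prod_decode])
  moreover have "(\<Union>n. W n) = E"
  proof -
    have "(\<Union>n. W n) = (\<Union>k l. T k l)"
    proof (intro equalityI subsetI)
      fix x assume "x \<in> (\<Union>k l. T k l)"
      then obtain k l where "x \<in> T k l" by blast
      then have "x \<in> W (prod_encode (k, l))" by (simp add: W_def)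
      then show "x \<in> (\<Union>n. W n)" by blast
    qed (auto simp: W_def)
    then show ?thesis using T(2) S(2) by simp
  qed
  moreover have "(\<Sum>n<N. P (W n)) \<le> P E + ereal \<epsilon>" for N
  proof -
    have sub: "prod_decode ` {..<N} \<subseteq> {..<N} \<times> {..<N}"
    proof
      fix x assume "x \<in> prod_decode ` {..<N}"
      then obtain n where n: "x = prod_decode n" "n < N" by blast
      then have "prod_encode x = n" by simp
      with n(2) show "x \<in> {..<N} \<times> {..<N}"
        using le_prod_encode_1[of "fst x" "snd x"] le_prod_encode_2[of "snd x" "fst x"] by (cases x) auto
    qed
    have "(\<Sum>n<N. P (W n)) = (\<Sum>(k, l)\<in>prod_decode ` {..<N}. P (T k l))"
      by (subst sum.reindex) (auto simp: W_def case_prod_beta intro: inj_on_subset[OF inj_prod_decode])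
    also have "\<dots> \<le> (\<Sum>(k, l)\<in>{..<N} \<times> {..<N}. P (T k l))"
      by (rule sum_mono2[OF _ sub]) (auto simp: perimeter_nonneg)
    also have "\<dots> = (\<Sum>k<N. \<Sum>l<N. P (T k l))" by (rule sum.cartesian_product[symmetric])
    also have "\<dots> \<le> (\<Sum>k<N. P (S k) + ereal (\<epsilon> / 2 / 2 ^ Suc k))"
      by (intro sum_mono T(5))
    also have "\<dots> = (\<Sum>k<N. P (S k)) + ereal (\<Sum>k<N. \<epsilon> / 2 / 2 ^ Suc k)"
      by (simp add: sum.distrib)
    also have "\<dots> \<le> (P E + ereal (\<epsilon> / 2)) + ereal (\<epsilon> / 2)"
      using sum_geometric_le[of "\<epsilon> / 2" N] \<open>\<epsilon> > 0\<close> by (intro add_mono S(4)) simp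
    also have "\<dots> = P E + ereal \<epsilon>" by (simp add: add.assoc)
    finally show ?thesis .
  qed
  ultimately show "\<exists>S :: nat \<Rightarrow> 'd point set. disjoint_family S \<and> (\<Union>k. S k) = E \<and>
     (\<forall>k. S k \<in> sets lebesgue \<and> bounded (S k)) \<and> (\<forall>N. (\<Sum>k<N. P (S k)) \<le> P E + ereal \<epsilon>)"
    using T(3,4) by (intro exI[of _ W]) (simp add: W_def)
qed

lemma frame_eq_left_field: "X i p = left_field gmult (X i 0) p"
proof -
  interpret grp: Groups.group gmult 0 uminus by (rule group)
  have "X i (gmult p 0) = frechet_derivative (gmult p) (at 0) (X i 0)"
    using X_left_invariant[of i] unfolding left_invariant_def by blast
  then show ?thesis by (simp add: left_field_def)
qed

text \<open>Modulo the \<open>(i+1)\<close>-st term the frame at \<open>x\<close> agrees with the frame at \<open>Q x\<close>, which stays in a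
  bounded set, and the coefficients of an admissible field are uniformly bounded.\<close>

lemma bounded_admissible_modulo:
  fixes L Q :: "'d point \<Rightarrow> 'd point"
  assumes r: "lower_central gmult r = {0}" "i < r"
    and L: "linear L" "\<And>x. L x = 0 \<longleftrightarrow> x \<in> lower_central gmult (Suc i)"
    and Q: "\<And>x. x - Q x \<in> lower_central gmult i" "bounded (Q ` E)"
  obtains C where "C \<ge> 0" "\<And>U x. U \<in> admissible_fields X K \<Longrightarrow> x \<in> E \<Longrightarrow> norm (L (U x)) \<le> C"
proof -
  obtain M where M: "M \<ge> 0" "\<And>p u i. to_origin p u \<in> K \<Longrightarrow> \<bar>g p u (X i p)\<bar> \<le> M"
    by (rule bounded_frame_coefficients) (rule that)
  have LX: "L (X j x) = L (X j (Q x))" for j x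
  proof -
    have "left_field gmult (X j 0) (Q x + (x - Q x)) - left_field gmult (X j 0) (Q x)
        \<in> lower_central gmult (Suc i)"
      by (rule left_field_modulo_lower_central[OF r Q(1)])
    moreover have "Q x + (x - Q x) = x" by simp
    ultimately have "X j x - X j (Q x) \<in> lower_central gmult (Suc i)"
      by (simp only: frame_eq_left_field[symmetric])
    then have "L (X j x - X j (Q x)) = 0" by (simp only: L(2))
    then show ?thesis by (simp add: linear_diff[OF L(1)])
  qed
  have "\<exists>B. \<forall>x\<in>E. norm (L (X j x)) \<le> B" for j
  proof -
    have "continuous_on UNIV (left_field gmult (X j 0))" by (rule C1_continuous[OF C1_left_field])
    moreover have "left_field gmult (X j 0) = X j" by (rule ext) (rule frame_eq_left_field[symmetric])
    ultimately have "continuous_on UNIV (X j)" by (simp only:)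
    then have "continuous_on (closure (Q ` E)) (X j)" by (rule continuous_on_subset) simp
    then have "compact (X j ` closure (Q ` E))"
      using Q(2) by (intro compact_continuous_image) (auto simp: compact_closure)
    then have "bounded (L ` X j ` closure (Q ` E))"
      using L(1) by (intro bounded_linear_image compact_imp_bounded) (simp_all add: linear_conv_bounded_linear)
    then obtain B where "\<And>y. y \<in> L ` X j ` closure (Q ` E) \<Longrightarrow> norm y \<le> B"
      unfolding bounded_iff by blast
    moreover have "L (X j x) \<in> L ` X j ` closure (Q ` E)" if "x \<in> E" for x
      unfolding LX[of j x] using closure_subset[of "Q ` E"] that by blast
    ultimately show ?thesis by blast
  qed
  then have "\<forall>j. \<exists>B. \<forall>x\<in>E. norm (L (X j x)) \<le> B" by blast
  from choice[OF this] obtain B where B: "\<forall>j. \<forall>x\<in>E. norm (L (X j x)) \<le> B j" ..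
  show thesis
  proof (rule that)
    show "0 \<le> (\<Sum>j\<in>UNIV. M * \<bar>B j\<bar>)" using M(1) by (intro sum_nonneg) simp
    fix U x assume U: "U \<in> admissible_fields X K" and x: "x \<in> E"
    have Ux: "U x \<in> horizontal X x" "to_origin x (U x) \<in> K" using U by (simp_all add: admissible_iff)
    have "L (U x) = (\<Sum>j\<in>UNIV. g x (U x) (X j x) *\<^sub>R L (X j x))"
      by (subst horizontal_frame_expansion[OF Ux(1)]) (simp add: linear_sum[OF L(1)] linear_scale[OF L(1)])
    also have "norm \<dots> \<le> (\<Sum>j\<in>UNIV. M * \<bar>B j\<bar>)"
    proof (rule sum_norm_le)
      fix j
      have "norm (L (X j x)) \<le> \<bar>B j\<bar>" using B x by (meson abs_ge_self order_trans)
      then show "norm (g x (U x) (X j x) *\<^sub>R L (X j x)) \<le> M * \<bar>B j\<bar>"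
        unfolding norm_scaleR by (intro mult_mono M Ux) auto
    qed
    finally show "norm (L (U x)) \<le> (\<Sum>j\<in>UNIV. M * \<bar>B j\<bar>)" .
  qed
qed

text \<open>The summand \<open>1\<close> removes the singularity of the norm at the kernel of \<open>L\<close>.\<close>

lemma smooth_norm_of_linear:
  fixes L :: "'d point \<Rightarrow> 'd point"
  assumes L: "linear L"
  defines "\<phi> \<equiv> \<lambda>x. sqrt (1 + L x \<bullet> L x)"
  shows "C1 \<phi>" and "\<bar>frechet_derivative \<phi> (at x) v\<bar> \<le> norm (L v)" and "norm (L x) \<le> \<phi> x"
proof -
  have bl: "bounded_linear L" using L by (simp add: linear_conv_bounded_linear)
  have pos: "1 + L x \<bullet> L x > 0" for x by (simp add: add_pos_nonneg)
  have D: "(\<phi> has_derivative (\<lambda>v. (L x \<bullet> L v) / \<phi> x)) (at x)" for x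
  proof -
    have "((\<lambda>x. 1 + L x \<bullet> L x) has_derivative (\<lambda>v. 0 + (L x \<bullet> L v + L v \<bullet> L x))) (at x)"
      by (intro has_derivative_add has_derivative_const has_derivative_inner
          bounded_linear.has_derivative[OF bl has_derivative_ident])
    from has_derivative_real_compose[OF DERIV_real_sqrt[OF pos] this]
    show ?thesis unfolding \<phi>_def by (simp add: inner_commute field_simps)
  qed
  have cL: "continuous_on UNIV L" using bl by (rule linear_continuous_on)
  show "C1 \<phi>"
  proof (rule C1I[OF D])
    have "sqrt (1 + L x \<bullet> L x) \<noteq> 0" for x using pos[of x] by simp
    then show "continuous_on UNIV (\<lambda>x. L x \<bullet> L v / \<phi> x)" for v
      unfolding \<phi>_def by (intro continuous_intros cL ballI)
  qed
  show n: "norm (L x) \<le> \<phi> x" for x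
    unfolding \<phi>_def norm_eq_sqrt_inner by simp
  have "frechet_derivative \<phi> (at x) v = (L x \<bullet> L v) / \<phi> x"
    using frechet_derivative_at[OF D[of x]] by (simp add: fun_eq_iff)
  moreover have "\<bar>L x \<bullet> L v\<bar> \<le> norm (L v) * \<phi> x"
    using Cauchy_Schwarz_ineq2[of "L x" "L v"] mult_right_mono[OF n[of x], of "norm (L v)"]
    by (simp add: mult.commute)
  moreover have "\<phi> x > 0" using pos by (simp add: \<phi>_def)
  ultimately show "\<bar>frechet_derivative \<phi> (at x) v\<bar> \<le> norm (L v)"
    by (simp add: abs_divide pos_divide_le_eq)
qed

text \<open>Downward induction: shells of the smoothed norm modulo the \<open>(i+1)\<close>-st term are bounded modulo
  that term, hence decomposable, and decompositions can be nested.\<close>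

lemma decomposable_bounded_modulo:
  fixes Q :: "nat \<Rightarrow> 'd point \<Rightarrow> 'd point"
  assumes r: "lower_central gmult r = {0}"
    and Q: "\<And>i. linear (Q i)" "\<And>i x. Q i x = 0 \<longleftrightarrow> x \<in> lower_central gmult i"
      "\<And>i x. x - Q i x \<in> lower_central gmult i"
    and "i \<le> r" and E: "E \<in> sets lebesgue" "emeasure lebesgue E < \<infinity>" "bounded (Q i ` E)"
  shows "decomposable E"
  using \<open>i \<le> r\<close> E
proof (induction arbitrary: E rule: inc_induct)
  case base
  have "x - Q r x = 0" for x using Q(3)[of x r] unfolding r by simp
  then have "Q r ` E = E" by simp
  with base show ?case by (simp add: decomposable_bounded)
next
  case (step i)
  obtain C where C: "C \<ge> 0" "\<And>U x. U \<in> admissible_fields X K \<Longrightarrow> x \<in> E \<Longrightarrow> norm (Q (Suc i) (U x)) \<le> C"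
    using bounded_admissible_modulo[OF r step.hyps(2) Q(1) Q(2) Q(3) step.prems(3)] by blast
  define \<phi> where "\<phi> x = sqrt (1 + Q (Suc i) x \<bullet> Q (Suc i) x)" for x
  note \<phi> = smooth_norm_of_linear[OF Q(1)[of "Suc i"], folded \<phi>_def]
  have \<phi>0: "0 \<le> \<phi> x" for x using \<phi>(3)[of x] norm_ge_zero order_trans by blast
  have C': "\<bar>frechet_derivative \<phi> (at x) (U x)\<bar> \<le> C" if "U \<in> admissible_fields X K" "x \<in> E" for U x
    using \<phi>(2)[of x "U x"] C(2)[OF that] by (rule order_trans)
  show ?case
  proof (rule decomposable_nest)
    fix \<epsilon> :: real assume "\<epsilon> > 0"
    have "\<exists>S :: nat \<Rightarrow> 'd point set. disjoint_family S \<and> (\<Union>k. S k) = E \<and>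
      (\<forall>k. S k \<in> sets lebesgue \<and> (\<exists>B. \<forall>x\<in>S k. \<phi> x \<le> B)) \<and>
      (\<forall>N. (\<Sum>k<N. P (S k)) \<le> P E + ereal \<epsilon>)"
      by (rule perimeter_shells[OF \<phi>(1) \<phi>0 step.prems(1,2) C(1) _ \<open>\<epsilon> > 0\<close>]) (rule C')
    then obtain S :: "nat \<Rightarrow> 'd point set" where S: "disjoint_family S" "(\<Union>k. S k) = E"
      "\<forall>k. S k \<in> sets lebesgue \<and> (\<exists>B. \<forall>x\<in>S k. \<phi> x \<le> B)"
      "\<forall>N. (\<Sum>k<N. P (S k)) \<le> P E + ereal \<epsilon>"
      by (elim exE conjE) (rule that)
    have "decomposable (S k)" for k
    proof (rule step.IH)
      show "S k \<in> sets lebesgue" using S(3) by blast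
      have "S k \<subseteq> E" using S(2) by blast
      then have "emeasure lebesgue (S k) \<le> emeasure lebesgue E"
        by (rule emeasure_mono) (rule step.prems(1))
      then show "emeasure lebesgue (S k) < \<infinity>" using step.prems(2) by (rule le_less_trans)
      from S(3) obtain B where "\<forall>x\<in>S k. \<phi> x \<le> B" by blast
      then show "bounded (Q (Suc i) ` S k)"
        unfolding bounded_iff using \<phi>(3) by (intro exI[of _ B]) (blast intro: order_trans)
    qed
    with S show "\<exists>S :: nat \<Rightarrow> 'd point set. disjoint_family S \<and> (\<Union>k. S k) = E \<and>
       (\<forall>k. decomposable (S k)) \<and> (\<forall>N. (\<Sum>k<N. P (S k)) \<le> P E + ereal \<epsilon>)"
      by (intro exI[of _ S]) simp
  qed
qed

lemma decomposable_finite_measure: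
  assumes E: "E \<in> sets lebesgue" "emeasure lebesgue E < \<infinity>"
  shows "decomposable E"
proof -
  obtain r where r: "lower_central gmult r = {0}"
    using nilpotent unfolding lie_nilpotent_def ..
  have ex: "\<forall>i. \<exists>Q :: 'd point \<Rightarrow> 'd point. linear Q \<and> (\<forall>x. Q x = 0 \<longleftrightarrow> x \<in> lower_central gmult i) \<and>
    (\<forall>x. x - Q x \<in> lower_central gmult i)"
  proof
    fix i
    obtain Q :: "'d point \<Rightarrow> 'd point" where "linear Q" "\<And>x. Q x = 0 \<longleftrightarrow> x \<in> lower_central gmult i"
      "\<And>x. x - Q x \<in> lower_central gmult i"
      by (rule linear_projection_off_subspace[OF subspace_lower_central[of i]]) (rule that)
    then show "\<exists>Q :: 'd point \<Rightarrow> 'd point. linear Q \<and> (\<forall>x. Q x = 0 \<longleftrightarrow> x \<in> lower_central gmult i) \<and>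
      (\<forall>x. x - Q x \<in> lower_central gmult i)" by (intro exI[of _ Q]) simp
  qed
  from choice[OF ex] obtain Q :: "nat \<Rightarrow> 'd point \<Rightarrow> 'd point" where
    Q: "\<forall>i. linear (Q i) \<and> (\<forall>x. Q i x = 0 \<longleftrightarrow> x \<in> lower_central gmult i) \<and>
      (\<forall>x. x - Q i x \<in> lower_central gmult i)" ..
  have "Q 0 x = 0" for x using spec[OF Q, of 0] by simp
  then have "Q 0 ` E \<subseteq> {0}" by auto
  then have "bounded (Q 0 ` E)" by (rule bounded_subset[rotated]) simp
  then show ?thesis
    using Q by (intro decomposable_bounded_modulo[OF r, of Q 0] E) blast+
qed

section \<open>Placing the pieces\<close>

lemma emeasure_lebesgue_translate: "emeasure lebesgue ((+) z ` E) = emeasure lebesgue (E :: 'd point set)"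
  using emeasure_lebesgue_affine[of 1 z E] by (simp add: add.commute cong: image_cong)

lemma reassembled_pieces:
  assumes E: "E \<in> sets lebesgue"
    and S: "disjoint_family S" "(\<Union>k. S k) = E" "\<And>k::nat. S k \<in> sets lebesgue" "\<And>N. (\<Sum>k<N. P (S k)) \<le> B"
    and T: "\<And>k y. gmult (\<tau> k) y = \<tau> k + y" "disjoint_family (\<lambda>k. (+) (\<tau> k) ` S k)"
  defines "G \<equiv> \<Union>k. (+) (\<tau> k) ` S k"
  shows "G \<in> sets lebesgue" "emeasure lebesgue G = emeasure lebesgue E" "P G \<le> B"
proof -
  have sets: "(+) (\<tau> k) ` S k \<in> sets lebesgue" for k
    by (rule lebesgue_sets_translation[OF S(3)])
  show "G \<in> sets lebesgue" unfolding G_def using sets by auto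
  have "emeasure lebesgue G = (\<Sum>k. emeasure lebesgue ((+) (\<tau> k) ` S k))"
    unfolding G_def by (rule suminf_emeasure[symmetric]) (use sets T(2) in auto)
  also have "\<dots> = (\<Sum>k. emeasure lebesgue (S k))"
    by (simp only: emeasure_lebesgue_translate)
  also have "\<dots> = emeasure lebesgue E"
    unfolding S(2)[symmetric] by (rule suminf_emeasure) (use S in auto)
  finally show "emeasure lebesgue G = emeasure lebesgue E" .
  show "P G \<le> B"
    unfolding G_def
  proof (rule perimeter_disjoint_Union_le[OF sets T(2)])
    fix N
    have "(\<Sum>k<N. P ((+) (\<tau> k) ` S k)) \<le> (\<Sum>k<N. P (S k))"
      by (intro sum_mono perimeter_translate_le T(1) S(3))
    also note S(4)
    finally show "(\<Sum>k<N. P ((+) (\<tau> k) ` S k)) \<le> B" .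
  qed
qed

lemma separating_translations:
  fixes S :: "nat \<Rightarrow> 'd point set"
  assumes "\<And>k. bounded (S k)" and z: "norm z = 1"
  obtains t where "disjoint_family (\<lambda>k. (+) (t k *\<^sub>R z) ` S k)"
proof -
  have "\<forall>k. \<exists>\<rho>. 0 < \<rho> \<and> (\<forall>x\<in>S k. norm x < \<rho>)"
  proof
    fix k
    obtain b where b: "b > 0" "\<forall>x\<in>S k. norm x \<le> b"
      using assms(1)[of k] unfolding bounded_pos by blast
    then show "\<exists>\<rho>. 0 < \<rho> \<and> (\<forall>x\<in>S k. norm x < \<rho>)"
      by (intro exI[of _ "b + 1"]) force
  qed
  from choice[OF this] obtain \<rho> where \<rho>: "\<forall>k. 0 < \<rho> k \<and> (\<forall>x\<in>S k. norm x < \<rho> k)" ..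
  \<comment> \<open>Consecutive intervals of radius \<open>\<rho> k\<close> on the line, each centred at \<open>t k\<close>.\<close>
  define t where "t k = \<rho> k + (\<Sum>i<k. 2 * \<rho> i)" for k
  have gap: "t j - t i \<ge> \<rho> i + \<rho> j" if "i < j" for i j
  proof -
    have "(\<Sum>l<Suc i. 2 * \<rho> l) \<le> (\<Sum>l<j. 2 * \<rho> l)"
      using that \<rho> by (intro sum_mono2) (auto intro: less_imp_le)
    then show ?thesis by (simp add: t_def)
  qed
  have disj: "(+) (t i *\<^sub>R z) ` S i \<inter> (+) (t j *\<^sub>R z) ` S j = {}" if "i < j" for i j
  proof (rule ccontr)
    assume "(+) (t i *\<^sub>R z) ` S i \<inter> (+) (t j *\<^sub>R z) ` S j \<noteq> {}"
    then obtain x y where xy: "x \<in> S i" "y \<in> S j" "t i *\<^sub>R z + x = t j *\<^sub>R z + y" by auto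
    from xy(3) have "x = t j *\<^sub>R z + y - t i *\<^sub>R z" by (metis add_diff_cancel_left')
    then have "(t j - t i) *\<^sub>R z = x - y" by (simp add: algebra_simps)
    then have "\<bar>t j - t i\<bar> = norm (x - y)" using z by (metis mult.right_neutral norm_scaleR)
    also have "\<dots> \<le> norm x + norm y" by (rule norm_triangle_ineq4)
    also have "\<dots> < \<rho> i + \<rho> j" using \<rho> xy(1,2) by (intro add_strict_mono) auto
    finally show False using gap[OF that] by linarith
  qed
  show thesis
  proof (rule that, unfold disjoint_family_on_def, intro ballI impI)
    fix i j :: nat assume "i \<noteq> j"
    then consider "i < j" | "j < i" by linarith
    then show "(+) (t i *\<^sub>R z) ` S i \<inter> (+) (t j *\<^sub>R z) ` S j = {}"
    proof cases
      case 2
      from disj[OF this] show ?thesis by (simp only: Int_commute)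
    qed (rule disj)
  qed
qed

text \<open>The pieces of both sets are interleaved into one sequence, \<open>E\<close> at the even and \<open>F\<close> at the odd
  indices, and moved apart together.\<close>

lemma disjoint_rearrangement:
  assumes E: "E \<in> sets lebesgue" "emeasure lebesgue E < \<infinity>"
    and F: "F \<in> sets lebesgue" "emeasure lebesgue F < \<infinity>" and "\<epsilon> > 0"
  obtains G where "G \<in> sets lebesgue" "emeasure lebesgue G = emeasure lebesgue E + emeasure lebesgue F"
    "P G \<le> P E + P F + ereal \<epsilon>"
proof -
  have e2: "\<epsilon> / 2 > 0" using \<open>\<epsilon> > 0\<close> by simp
  from decomposable_finite_measure[OF E, unfolded decomposable_def, rule_format, OF e2]
  obtain S :: "nat \<Rightarrow> 'd point set" where S: "disjoint_family S" "(\<Union>k. S k) = E"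
    "\<forall>k. S k \<in> sets lebesgue \<and> bounded (S k)" "\<forall>N. (\<Sum>k<N. P (S k)) \<le> P E + ereal (\<epsilon> / 2)"
    by (elim exE conjE) (rule that)
  from decomposable_finite_measure[OF F, unfolded decomposable_def, rule_format, OF e2]
  obtain T :: "nat \<Rightarrow> 'd point set" where T: "disjoint_family T" "(\<Union>k. T k) = F"
    "\<forall>k. T k \<in> sets lebesgue \<and> bounded (T k)" "\<forall>N. (\<Sum>k<N. P (T k)) \<le> P F + ereal (\<epsilon> / 2)"
    by (elim exE conjE) (rule that)
  have S': "S k \<in> sets lebesgue" "(\<Sum>k<N. P (S k)) \<le> P E + ereal (\<epsilon> / 2)" for k N
    using S(3,4) by simp_all
  have T': "T k \<in> sets lebesgue" "(\<Sum>k<N. P (T k)) \<le> P F + ereal (\<epsilon> / 2)" for k N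
    using T(3,4) by simp_all
  obtain z where z: "norm z = 1" "\<And>t y. gmult (t *\<^sub>R z) y = t *\<^sub>R z + y"
    by (rule central_direction) (rule that)
  define W where "W k = (if even k then S (k div 2) else T (k div 2))" for k :: nat
  have "bounded (W k)" for k using S(3) T(3) by (simp add: W_def)
  then obtain t where t: "disjoint_family (\<lambda>k. (+) (t k *\<^sub>R z) ` W k)"
    using z(1) by (rule separating_translations) (rule that)
  have tD: "(+) (t i *\<^sub>R z) ` W i \<inter> (+) (t j *\<^sub>R z) ` W j = {}" if "i \<noteq> j" for i j
    using t that unfolding disjoint_family_on_def by simp
  define GE where "GE = (\<Union>k. (+) (t (2 * k) *\<^sub>R z) ` S k)"
  define GF where "GF = (\<Union>k. (+) (t (2 * k + 1) *\<^sub>R z) ` T k)"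
  have "disjoint_family (\<lambda>k. (+) (t (2 * k) *\<^sub>R z) ` S k)"
    unfolding disjoint_family_on_def
  proof (intro ballI impI)
    fix m n :: nat assume "m \<noteq> n"
    then show "(+) (t (2 * m) *\<^sub>R z) ` S m \<inter> (+) (t (2 * n) *\<^sub>R z) ` S n = {}"
      using tD[of "2 * m" "2 * n"] by (simp add: W_def)
  qed
  then have GE: "GE \<in> sets lebesgue" "emeasure lebesgue GE = emeasure lebesgue E" "P GE \<le> P E + ereal (\<epsilon> / 2)"
    unfolding GE_def by (intro reassembled_pieces[OF E(1) S(1,2) S'(1,2) z(2)]; assumption)+
  have "disjoint_family (\<lambda>k. (+) (t (2 * k + 1) *\<^sub>R z) ` T k)"
    unfolding disjoint_family_on_def
  proof (intro ballI impI)
    fix m n :: nat assume "m \<noteq> n"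
    then show "(+) (t (2 * m + 1) *\<^sub>R z) ` T m \<inter> (+) (t (2 * n + 1) *\<^sub>R z) ` T n = {}"
      using tD[of "2 * m + 1" "2 * n + 1"] by (simp add: W_def)
  qed
  then have GF: "GF \<in> sets lebesgue" "emeasure lebesgue GF = emeasure lebesgue F" "P GF \<le> P F + ereal (\<epsilon> / 2)"
    unfolding GF_def by (intro reassembled_pieces[OF F(1) T(1,2) T'(1,2) z(2)]; assumption)+
  have disj: "GE \<inter> GF = {}"
  proof -
    have "(+) (t (2 * m) *\<^sub>R z) ` S m \<inter> (+) (t (2 * n + 1) *\<^sub>R z) ` T n = {}" for m n
    proof -
      have "2 * m \<noteq> 2 * n + 1" by presburger
      from tD[OF this] show ?thesis by (simp add: W_def)
    qed
    then show ?thesis unfolding GE_def GF_def by blast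
  qed
  show thesis
  proof (rule that)
    show "GE \<union> GF \<in> sets lebesgue" using GE(1) GF(1) by (rule sets.Un)
    show "emeasure lebesgue (GE \<union> GF) = emeasure lebesgue E + emeasure lebesgue F"
      using plus_emeasure[OF GE(1) GF(1) disj] GE(2) GF(2) by simp
    have "P (GE \<union> GF) \<le> P GE + P GF" by (rule perimeter_disjoint_Un_le[OF GE(1) GF(1) disj])
    also have "\<dots> \<le> (P E + ereal (\<epsilon> / 2)) + (P F + ereal (\<epsilon> / 2))" by (rule add_mono[OF GE(3) GF(3)])
    also have "\<dots> = P E + P F + (ereal (\<epsilon> / 2) + ereal (\<epsilon> / 2))" by (simp only: add_ac)
    finally show "P (GE \<union> GF) \<le> P E + P F + ereal \<epsilon>" by simp
  qed
qed

end

theorem corollary4p4: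
  fixes gmult :: "('d::{finite,linorder}) group_op"
    and X :: "'k::finite \<Rightarrow> 'd vfield"
    and K :: "'d point set"
    and g :: "'d metric_tensor"
    and V :: "'d subbundle"
    and v w :: real
  assumes "sub_finsler_nilpotent_group gmult X K g V"
    and "v > 0" and "w > 0"
  shows "isoperimetric_profile X K g (v + w)
           \<le> isoperimetric_profile X K g v + isoperimetric_profile X K g w"
proof -
  interpret sub_finsler_nilpotent_group gmult X K g V by (rule assms(1))
  let ?I = "isoperimetric_profile X K g"
  let ?A = "\<lambda>v. {E. finite_perimeter X K g E \<and> emeasure lebesgue E = ennreal v}"
  have nonneg: "0 \<le> ?I u" for u
    unfolding isoperimetric_profile_def by (intro INF_greatest perimeter_nonneg)
  have le: "?I (v + w) \<le> P E + P F" if E: "E \<in> ?A v" and F: "F \<in> ?A w" for E F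
  proof (rule ereal_le_epsilon2)
    fix \<epsilon> :: real assume "\<epsilon> > 0"
    have E': "E \<in> sets lebesgue" "emeasure lebesgue E = ennreal v" "P E < \<infinity>"
      and F': "F \<in> sets lebesgue" "emeasure lebesgue F = ennreal w" "P F < \<infinity>"
      using E F by (simp_all add: finite_perimeter_def)
    obtain G where G: "G \<in> sets lebesgue" "emeasure lebesgue G = emeasure lebesgue E + emeasure lebesgue F"
      "P G \<le> P E + P F + ereal \<epsilon>"
      by (rule disjoint_rearrangement[OF E'(1) _ F'(1) _ \<open>\<epsilon> > 0\<close>]) (simp_all add: E'(2) F'(2))
    have "emeasure lebesgue G = ennreal (v + w)"
      using assms(2,3) by (simp add: G(2) E'(2) F'(2))
    moreover have "P G < \<infinity>"
      using G(3) E'(3) F'(3) by (auto intro: le_less_trans)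
    ultimately have "G \<in> ?A (v + w)" using G(1) by (simp add: finite_perimeter_def)
    then have "?I (v + w) \<le> P G" unfolding isoperimetric_profile_def by (rule INF_lower)
    then show "?I (v + w) \<le> P E + P F + ereal \<epsilon>" using G(3) by (rule order_trans)
  qed
  show ?thesis
  proof (cases "?A v = {} \<or> ?A w = {}")
    case True
    moreover have "?A u = {} \<Longrightarrow> ?I u = \<infinity>" for u
      unfolding isoperimetric_profile_def by (simp only: image_empty Inf_empty top_ereal_def)
    ultimately have "?I v = \<infinity> \<or> ?I w = \<infinity>" by blast
    then have "?I v + ?I w = \<infinity>" using nonneg[of v] nonneg[of w] by auto
    show ?thesis unfolding \<open>?I v + ?I w = \<infinity>\<close> by simp
  next
    case False
    have inner: "(INF F\<in>?A w. P E + P F) = P E + ?I w" for E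
      unfolding isoperimetric_profile_def
      by (rule INF_ereal_add_right) (use False perimeter_nonneg[of E] in \<open>auto simp: perimeter_nonneg\<close>)
    have "?I (v + w) \<le> (INF E\<in>?A v. INF F\<in>?A w. P E + P F)"
      by (intro INF_greatest le)
    also have "\<dots> = (INF E\<in>?A v. P E + ?I w)"
      by (simp only: inner)
    also have "\<dots> = ?I v + ?I w"
      unfolding isoperimetric_profile_def[of _ _ _ v]
      by (rule INF_ereal_add_left) (use False nonneg[of w] in \<open>auto simp: perimeter_nonneg\<close>)
    finally show ?thesis .
  qed
qed

end
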